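(* Let $\gamma>0$, $C\in\mathbb{R}^{p\times n}$, $D\in\mathbb{R}^{p\times m}$, and write $C_{Y,L}:=CY+DL$. Let $$\Theta_{\mathcal{H}_2}:=\{(Y,L)\in\mathbb{S}^n\times\mathbb{R}^{m\times n}\mid \operatorname{tr}(Y^{-1})<\gamma^2\text{ and }Y-C_{Y,L}^\top C_{Y,L}>0\}$$ and let $M_{\mathcal{H}_2}:\Theta_{\mathcal{H}_2}\to\mathbb{S}^{n,n+m}$ be $$M_{\mathcal{H}_2}(Y,L):=\begin{bmatrix}Y&0\\ 0&-\begin{bmatrix}Y\\ L\end{bmatrix}(Y-C_{Y,L}^\top C_{Y,L})^{-1}\begin{bmatrix}Y\\ L\end{bmatrix}^\top\end{bmatrix}.$$ Let $Q\in\mathbb{S}^{n,n+m}$ be the data-dependent matrix defined in the context. The data $\mathcal{D}=(U_-,X)$ are informative for $M_{\mathcal{H}_2}$-control with respect to $\mathcal{W}_{\mathrm F}(\Phi)$ if and only if there exist matrices $Y,Z\in\mathbb{S}^n$ and $L\in\mathbb{R}^{m\times n}$ and scalars $\alpha\ge0$ and $\beta>0$ such that $$\begin{bmatrix}Y-\beta I&0&0&0&0\\ 0&0&0&Y&0\\ 0&0&0&L&0\\ 0&Y&L^\top&Y&C_{Y,L}^\top\\ 0&0&0&C_{Y,L}&I\end{bmatrix}-\alpha\begin{bmatrix}Q&0\\ 0&0\end{bmatrix}\ge0,\qquad(\ast)$$ $$\begin{bmatrix}Y&C_{Y,L}^\top\\ C_{Y,L}&I\end{bmatrix}>0,\qquad\begin{bmatrix}Z&I\\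 I&Y\end{bmatrix}\ge0,\qquad\operatorname{tr}(Z)<\gamma^2.\qquad(\ast\ast)$$ Moreover, if $Y$ and $L$ satisfy $(\ast)$ and $(\ast\ast)$ (for some $Z\in\mathbb{S}^n$, $\alpha\ge0$, $\beta>0$), then $K:=LY^{-1}$ is such that $A+BK$ is stable and $\|G(z)\|_{\mathcal{H}_2}<\gamma$ for all $(A,B)\in\Sigma_{\mathcal D}(\mathcal{W}_{\mathrm F}(\Phi))$, where $G(z)=(C+DK)(zI-(A+BK))^{-1}$.
   Context: Notation. All matrices are real. $\mathbb{S}^n$: symmetric $n\times n$ matrices; $\ge,>,\le,<$ between symmetric matrices refer to (semi)definiteness. $\mathbb{S}^{p,q}$: symmetric $(p+q)\times(p+q)$ matrices partitioned as $\Pi=\begin{bmatrix}\Pi_{11}&\Pi_{12}\\ \Pi_{21}&\Pi_{22}\end{bmatrix}$ with $\Pi_{11}\in\mathbb{S}^p$, $\Pi_{22}\in\mathbb{S}^q$. $Y^\dagger$ is the Moore-Penrose pseudoinverse, $\otimes$ the Kronecker product, $\operatorname{vec}(Y)$ the column-stacking vectorization. $\Pi|\Pi_{22}:=\Pi_{11}-\Pi_{12}\Pi_{22}^{\dagger}\Pi_{21}$, and $\mathbf{\Pi}_{p,q}:=\{\Pi\in\mathbb{S}^{p,q}\mid \Pi_{22}\le 0,\ \ker\Pi_{22}\subseteq\ker\Pi_{12},\ \Pi|\Pi_{22}\ge 0\}$. A square matrix is stable if all its eigenvalues lie in the open unit disc; $\|\cdot\|_{\mathcal{H}_2}$ is the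 (discrete-time) $\mathcal{H}_2$ norm of a transfer matrix. Data and noise model. Let $n,m,p,T$ be positive integers. The data $\mathcal{D}=(U_-,X)$ consist of $U_-=[u(0)\ \cdots\ u(T-1)]\in\mathbb{R}^{m\times T}$ and $X=[x(0)\ \cdots\ x(T)]\in\mathbb{R}^{n\times(T+1)}$; put $X_-=[x(0)\ \cdots\ x(T-1)]$, $X_+=[x(1)\ \cdots\ x(T)]$. Let $\Phi\in\mathbf{\Pi}_{1,nT}$ be given, with $\Phi_{22}=\phi\otimes I_n$ for some $\phi\in\mathbb{S}^T$, and let $$\mathcal{W}_{\mathrm F}(\Phi):=\Big\{W\in\mathbb{R}^{n\times T}\ \Big|\ \begin{bmatrix}1\\ \operatorname{vec}(W)\end{bmatrix}^{\top}\Phi\begin{bmatrix}1\\ \operatorname{vec}(W)\end{bmatrix}\ge 0\Big\}.$$ The set of data-compatible systems is $\Sigma_{\mathcal D}(\mathcal{W}_{\mathrm F}(\Phi)):=\{(A,B)\in\mathbb{R}^{n\times n}\times\mathbb{R}^{n\times m}\mid X_+=AX_-+BU_-+W\text{ for some }W\in\mathcal{W}_{\mathrm F}(\Phi)\}$. The data are generated by a true (unknown) system $(A_s,B_s)$ with noise matrix in $\mathcal{W}_{\mathrm F}(\Phi)$, i.e. $(A_s,B_s)\in\Sigma_{\mathcal D}(\mathcal{W}_{\mathrm F}(\Phi))$. The performance output is $y(t)=Cx(t)+Du(t)$, and $G(z)$ is the transfer matrix from the noise $w$ to $y$ of the closed loop of $x(t+1)=Ax(t)+Bu(t)+w(t)$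 with $u=Kx$. Informativity. For a set $\Theta$ and $M:\Theta\to\mathbb{S}^{n,n+m}$ with $M_{22}(\theta)\le0$ for all $\theta$, the data are informative for $M$-control with respect to $\mathcal{W}_{\mathrm F}(\Phi)$ if there exists $\theta\in\Theta$ such that $$\begin{bmatrix}I\\ A^\top\\ B^\top\end{bmatrix}^{\top}M(\theta)\begin{bmatrix}I\\ A^\top\\ B^\top\end{bmatrix}>0\quad\text{for all }(A,B)\in\Sigma_{\mathcal D}(\mathcal{W}_{\mathrm F}(\Phi)).$$ The matrices $N$ and $Q$. Let $$E:=\begin{bmatrix}1&0\\ \operatorname{vec}(X_+)&-\begin{bmatrix}X_-\\ U_-\end{bmatrix}^{\top}\otimes I_n\end{bmatrix},\qquad N:=E^{\top}\Phi E\in\mathbb{S}^{1,n(n+m)},$$ $$Q_{22}:=\begin{bmatrix}X_-\\ U_-\end{bmatrix}\phi\begin{bmatrix}X_-\\ U_-\end{bmatrix}^{\top},\qquad Q:=\begin{bmatrix}(N|N_{22})I_n+Q_{12}Q_{22}^{\dagger}Q_{21}&Q_{12}\\ Q_{21}&Q_{22}\end{bmatrix}\in\mathbb{S}^{n,n+m},$$ where $Q_{12}\in\mathbb{R}^{n\times(n+m)}$ is determined by $\operatorname{vec}(Q_{12})=N_{21}$ and $Q_{21}=Q_{12}^\top$. In the $5\times5$ block inequality of the claim the diagonal blocks have sizes $n,n,m,n,p$, and $Q$ is padded with zeros in the last $n+p$ rows and columns. *)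

theory Defs
  imports "HOL-Analysis.Analysis"
begin

section \<open>Matrices\<close>

text \<open>
  A real matrix with rows indexed by \<open>'r\<close> and columns indexed by \<open>'c\<close> has type
  \<open>real ^ 'c ^ 'r\<close>; a \<open>k \<times> l\<close> matrix has \<open>k = CARD('r)\<close> and \<open>l = CARD('c)\<close>.
  Sum types index the rows and columns of block matrices, product types those of Kronecker
  products and vectorizations. The type \<open>1\<close> is the singleton index, so column vectors are
  matrices of type \<open>real ^ 1 ^ 'r\<close>.
\<close>

definition symmetric_mat :: "real ^ 'n ^ 'n \<Rightarrow> bool" where
  "symmetric_mat A \<longleftrightarrow> transpose A = A"

definition psd :: "real ^ 'n ^ 'n \<Rightarrow> bool" where
  "psd A \<longleftrightarrow> symmetric_mat A \<and> (\<forall>v. 0 \<le> v \<bullet> (A *v v))"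

definition pd :: "real ^ 'n ^ 'n \<Rightarrow> bool" where
  "pd A \<longleftrightarrow> symmetric_mat A \<and> (\<forall>v. v \<noteq> 0 \<longrightarrow> 0 < v \<bullet> (A *v v))"

definition ker :: "real ^ 'c ^ 'r \<Rightarrow> (real ^ 'c) set" where
  "ker A = {v. A *v v = 0}"

definition hstack :: "'a ^ 'c ^ 'r \<Rightarrow> 'a ^ 'd ^ 'r \<Rightarrow> 'a ^ ('c::finite + 'd::finite) ^ 'r" where
  "hstack A B = (\<chi> i j. case j of Inl k \<Rightarrow> A $ i $ k | Inr k \<Rightarrow> B $ i $ k)"

definition vstack :: "'a ^ 'c ^ 'r \<Rightarrow> 'a ^ 'c ^ 's \<Rightarrow> 'a ^ 'c ^ ('r::finite + 's::finite)" where
  "vstack A B = (\<chi> i. case i of Inl k \<Rightarrow> A $ k | Inr k \<Rightarrow> B $ k)"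

definition block2 ::
  "'a ^ 'c ^ 'r \<Rightarrow> 'a ^ 'd ^ 'r \<Rightarrow> 'a ^ 'c ^ 's \<Rightarrow> 'a ^ 'd ^ 's
    \<Rightarrow> 'a ^ ('c::finite + 'd::finite) ^ ('r::finite + 's::finite)" where
  "block2 A B C D = vstack (hstack A B) (hstack C D)"

definition blk11 :: "'a ^ ('c::finite + 'd::finite) ^ ('r::finite + 's::finite) \<Rightarrow> 'a ^ 'c ^ 'r" where
  "blk11 P = (\<chi> i j. P $ Inl i $ Inl j)"

definition blk12 :: "'a ^ ('c::finite + 'd::finite) ^ ('r::finite + 's::finite) \<Rightarrow> 'a ^ 'd ^ 'r" where
  "blk12 P = (\<chi> i j. P $ Inl i $ Inr j)"

definition blk21 :: "'a ^ ('c::finite + 'd::finite) ^ ('r::finite + 's::finite) \<Rightarrow> 'a ^ 'c ^ 's" where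
  "blk21 P = (\<chi> i j. P $ Inr i $ Inl j)"

definition blk22 :: "'a ^ ('c::finite + 'd::finite) ^ ('r::finite + 's::finite) \<Rightarrow> 'a ^ 'd ^ 's" where
  "blk22 P = (\<chi> i j. P $ Inr i $ Inr j)"

text \<open>
  A row and a column of five blocks. The bracketing \<open>(3 + 2)\<close> makes the leading three blocks of a
  \<open>5 \<times> 5\<close> block matrix its (1,1) block in the sense of \<^const>\<open>block2\<close>.
\<close>

definition row5 ::
  "'a ^ 'a1 ^ 'r \<Rightarrow> 'a ^ 'a2 ^ 'r \<Rightarrow> 'a ^ 'a3 ^ 'r \<Rightarrow> 'a ^ 'a4 ^ 'r \<Rightarrow> 'a ^ 'a5 ^ 'r
    \<Rightarrow> 'a ^ (('a1::finite + ('a2::finite + 'a3::finite)) + ('a4::finite + 'a5::finite)) ^ 'r" where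
  "row5 A B C D E = hstack (hstack A (hstack B C)) (hstack D E)"

definition col5 ::
  "'a ^ 'c ^ 'a1 \<Rightarrow> 'a ^ 'c ^ 'a2 \<Rightarrow> 'a ^ 'c ^ 'a3 \<Rightarrow> 'a ^ 'c ^ 'a4 \<Rightarrow> 'a ^ 'c ^ 'a5
    \<Rightarrow> 'a ^ 'c ^ (('a1::finite + ('a2::finite + 'a3::finite)) + ('a4::finite + 'a5::finite))" where
  "col5 A B C D E = vstack (vstack A (vstack B C)) (vstack D E)"

definition kron ::
  "real ^ 'c ^ 'r \<Rightarrow> real ^ 'd ^ 's \<Rightarrow> real ^ ('c::finite \<times> 'd::finite) ^ ('r::finite \<times> 's::finite)" where
  "kron A B = (\<chi> i j. A $ fst i $ fst j * B $ snd i $ snd j)"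

text \<open>
  The entry at row \<open>i\<close> and column \<open>j\<close> has index \<open>(j, i)\<close> in the vectorization: for lexicographically
  ordered pairs this is column stacking, and it matches the index convention of \<^const>\<open>kron\<close>.
\<close>

definition vectorize :: "real ^ 'c ^ 'r \<Rightarrow> real ^ 1 ^ ('c::finite \<times> 'r::finite)" where
  "vectorize A = (\<chi> k l. A $ snd k $ fst k)"

text \<open>The Moore-Penrose pseudoinverse, characterized by the four Penrose equations.\<close>

definition pinv :: "real ^ 'c ^ 'r \<Rightarrow> real ^ 'r ^ 'c" where
  "pinv A = (THE Y. A ** Y ** A = A \<and> Y ** A ** Y = Y \<and>
     transpose (A ** Y) = A ** Y \<and> transpose (Y ** A) = Y ** A)"

definition gen_schur :: "real ^ ('p::finite + 'q::finite) ^ ('p + 'q) \<Rightarrow> real ^ 'p ^ 'p" where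
  "gen_schur P = blk11 P - blk12 P ** pinv (blk22 P) ** blk21 P"

definition Pi_set :: "(real ^ ('p::finite + 'q::finite) ^ ('p + 'q)) set" where
  "Pi_set = {P. symmetric_mat P \<and> psd (- blk22 P) \<and> ker (blk22 P) \<subseteq> ker (blk12 P) \<and>
     psd (gen_schur P)}"


section \<open>Stability and the H2 norm\<close>

definition complex_mat :: "real ^ 'c ^ 'r \<Rightarrow> complex ^ 'c ^ 'r" where
  "complex_mat A = map_matrix complex_of_real A"

definition schur_stable :: "real ^ 'n ^ 'n \<Rightarrow> bool" where
  "schur_stable A \<longleftrightarrow>
     (\<forall>(z::complex) v. v \<noteq> 0 \<and> complex_mat A *v v = z *s v \<longrightarrow> norm z < 1)"

definition transfer_matrix :: "real ^ 'n ^ 'p \<Rightarrow> real ^ 'n ^ 'n \<Rightarrow> complex \<Rightarrow> complex ^ 'n ^ 'p" where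
  "transfer_matrix C A z = complex_mat C ** matrix_inv (mat z - complex_mat A)"

text \<open>
  The square of the discrete-time H2 norm is the mean over the unit circle of the trace of
  \<open>G(z)\<^sup>* G(z)\<close>, which is the sum of the squared moduli of the entries of \<open>G(z)\<close>. This is
  meaningful for transfer matrices of stable systems, which are continuous on the unit circle; for
  others the integral may take its default value \<open>0\<close>.
\<close>

definition h2_norm :: "(complex \<Rightarrow> complex ^ 'c ^ 'r) \<Rightarrow> real" where
  "h2_norm G = sqrt (1 / (2 * pi) *
     integral {- pi..pi} (\<lambda>t. \<Sum>i\<in>UNIV. \<Sum>j\<in>UNIV. (norm (G (cis t) $ i $ j))\<^sup>2))"


section \<open>Data\<close>

text \<open>
  The \<open>T = CARD('t)\<close> columns of the data matrices are indexed by a finite linearly ordered type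
  \<open>'t\<close>; \<open>time_of\<close> is its order isomorphism onto \<open>{0, \<dots>, T - 1}\<close>. The data consist of the samples
  \<open>u 0, \<dots>, u (T - 1)\<close> and \<open>x 0, \<dots>, x T\<close>; other values of the sequences \<open>u\<close> and \<open>x\<close> are never used.
\<close>

definition time_of :: "'t::{finite,linorder} \<Rightarrow> nat" where
  "time_of t = card {s. s < t}"

lemma time_of_strict_mono: "strict_mono (time_of :: 't::{finite,linorder} \<Rightarrow> nat)"
  unfolding strict_mono_def time_of_def by (auto intro!: psubset_card_mono)

lemma time_of_bij: "bij_betw (time_of :: 't::{finite,linorder} \<Rightarrow> nat) UNIV {..<CARD('t)}"
proof -
  have inj: "inj (time_of :: 't \<Rightarrow> nat)"
    using time_of_strict_mono by (rule strict_mono_imp_inj_on)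
  have "time_of t < CARD('t)" for t :: 't
    unfolding time_of_def by (rule psubset_card_mono) auto
  hence "range (time_of :: 't \<Rightarrow> nat) \<subseteq> {..<CARD('t)}" by auto
  moreover have "card (range (time_of :: 't \<Rightarrow> nat)) = card {..<CARD('t)}"
    using inj by (simp add: card_image)
  ultimately have "range (time_of :: 't \<Rightarrow> nat) = {..<CARD('t)}"
    by (intro card_subset_eq) auto
  with inj show ?thesis by (simp add: bij_betw_def)
qed

definition U_minus :: "(nat \<Rightarrow> real ^ 'm) \<Rightarrow> real ^ 't::{finite,linorder} ^ 'm" where
  "U_minus u = (\<chi> i t. u (time_of t) $ i)"

definition X_minus :: "(nat \<Rightarrow> real ^ 'n) \<Rightarrow> real ^ 't::{finite,linorder} ^ 'n" where
  "X_minus x = (\<chi> i t. x (time_of t) $ i)"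

definition X_plus :: "(nat \<Rightarrow> real ^ 'n) \<Rightarrow> real ^ 't::{finite,linorder} ^ 'n" where
  "X_plus x = (\<chi> i t. x (Suc (time_of t)) $ i)"

definition W_F ::
  "real ^ (1 + 't::finite \<times> 'n::finite) ^ (1 + 't \<times> 'n) \<Rightarrow> (real ^ 't ^ 'n) set" where
  "W_F \<Phi> = {W. 0 \<le>
     (transpose (vstack (mat 1) (vectorize W)) ** \<Phi> ** vstack (mat 1) (vectorize W)) $ 1 $ 1}"

definition Sigma_D ::
  "(nat \<Rightarrow> real ^ 'm) \<Rightarrow> (nat \<Rightarrow> real ^ 'n) \<Rightarrow> (real ^ 't::{finite,linorder} ^ 'n) set
    \<Rightarrow> ((real ^ 'n ^ 'n) \<times> (real ^ 'm ^ 'n)) set" where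
  "Sigma_D u x \<W> =
     {(A, B). \<exists>W\<in>\<W>. X_plus x = A ** X_minus x + B ** U_minus u + W}"

text \<open>
  Informativity is only considered for \<open>M\<close> that map \<open>\<Theta>\<close> to symmetric matrices with negative
  semidefinite (2,2) block; for the \<open>M\<close> used below this is lemma \<open>M_H2_admissible\<close>.
\<close>

definition informative ::
  "'\<theta> set \<Rightarrow> ('\<theta> \<Rightarrow> real ^ ('n::finite + ('n + 'm::finite)) ^ ('n + ('n + 'm)))
    \<Rightarrow> (nat \<Rightarrow> real ^ 'm) \<Rightarrow> (nat \<Rightarrow> real ^ 'n) \<Rightarrow> (real ^ 't::{finite,linorder} ^ 'n) set \<Rightarrow> bool" where
  "informative \<Theta> M u x \<W> \<longleftrightarrow>
     (\<exists>\<theta>\<in>\<Theta>. \<forall>(A, B)\<in>Sigma_D u x \<W>.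
        pd (transpose (vstack (mat 1) (vstack (transpose A) (transpose B))) ** M \<theta> **
            vstack (mat 1) (vstack (transpose A) (transpose B))))"


section \<open>The matrices N and Q\<close>

definition XU_minus ::
  "(nat \<Rightarrow> real ^ 'm) \<Rightarrow> (nat \<Rightarrow> real ^ 'n)
    \<Rightarrow> real ^ 't::{finite,linorder} ^ ('n::finite + 'm::finite)" where
  "XU_minus u x = vstack (X_minus x) (U_minus u)"

definition E_mat ::
  "(nat \<Rightarrow> real ^ 'm) \<Rightarrow> (nat \<Rightarrow> real ^ 'n)
    \<Rightarrow> real ^ (1 + ('n::finite + 'm::finite) \<times> 'n) ^ (1 + 't::{finite,linorder} \<times> 'n)" where
  "E_mat u x = block2
     (mat 1)               0
     (vectorize (X_plus x)) (- kron (transpose (XU_minus u x)) (mat 1))"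

definition N_mat ::
  "(nat \<Rightarrow> real ^ 'm) \<Rightarrow> (nat \<Rightarrow> real ^ 'n)
    \<Rightarrow> real ^ (1 + 't::{finite,linorder} \<times> 'n) ^ (1 + 't \<times> 'n)
    \<Rightarrow> real ^ (1 + ('n::finite + 'm::finite) \<times> 'n) ^ (1 + ('n + 'm) \<times> 'n)" where
  "N_mat u x \<Phi> = transpose (E_mat u x) ** \<Phi> ** E_mat u x"

definition Q22_mat ::
  "(nat \<Rightarrow> real ^ 'm) \<Rightarrow> (nat \<Rightarrow> real ^ 'n) \<Rightarrow> real ^ 't::{finite,linorder} ^ 't::{finite,linorder}
    \<Rightarrow> real ^ ('n::finite + 'm::finite) ^ ('n + 'm)" where
  "Q22_mat u x \<phi> = XU_minus u x ** \<phi> ** transpose (XU_minus u x)"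

definition Q12_mat ::
  "(nat \<Rightarrow> real ^ 'm) \<Rightarrow> (nat \<Rightarrow> real ^ 'n)
    \<Rightarrow> real ^ (1 + 't::{finite,linorder} \<times> 'n) ^ (1 + 't \<times> 'n)
    \<Rightarrow> real ^ ('n::finite + 'm::finite) ^ 'n" where
  "Q12_mat u x \<Phi> = (THE R. vectorize R = blk21 (N_mat u x \<Phi>))"

lemma vectorize_unique:
  fixes V :: "real ^ 1 ^ ('c::finite \<times> 'r::finite)"
  shows "\<exists>!R. vectorize R = V"
proof
  show "vectorize (\<chi> i j. V $ (j, i) $ 1) = V"
    by (simp add: vectorize_def vec_eq_iff)
next
  fix R :: "real ^ 'c ^ 'r"
  assume "vectorize R = V"
  thus "R = (\<chi> i j. V $ (j, i) $ 1)"
    by (auto simp: vectorize_def vec_eq_iff)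
qed

lemma vectorize_Q12: "vectorize (Q12_mat u x \<Phi>) = blk21 (N_mat u x \<Phi>)"
  unfolding Q12_mat_def by (rule theI') (rule vectorize_unique)

definition Q_mat ::
  "(nat \<Rightarrow> real ^ 'm) \<Rightarrow> (nat \<Rightarrow> real ^ 'n)
    \<Rightarrow> real ^ (1 + 't::{finite,linorder} \<times> 'n) ^ (1 + 't \<times> 'n) \<Rightarrow> real ^ 't::{finite,linorder} ^ 't::{finite,linorder}
    \<Rightarrow> real ^ ('n::finite + ('n + 'm::finite)) ^ ('n + ('n + 'm))" where
  "Q_mat u x \<Phi> \<phi> =
     (let N = N_mat u x \<Phi>; Q12 = Q12_mat u x \<Phi>; Q21 = transpose Q12; Q22 = Q22_mat u x \<phi>
      in block2 (gen_schur N $ 1 $ 1 *\<^sub>R mat 1 + Q12 ** pinv Q22 ** Q21) Q12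
                Q21                                                       Q22)"


section \<open>H2 control\<close>

definition C_cl :: "real ^ 'n ^ 'p \<Rightarrow> real ^ 'm ^ 'p \<Rightarrow> real ^ 'n ^ 'n \<Rightarrow> real ^ 'n ^ 'm \<Rightarrow> real ^ 'n ^ 'p" where
  "C_cl C D Y L = C ** Y + D ** L"

definition Theta_H2 ::
  "real \<Rightarrow> real ^ 'n ^ 'p \<Rightarrow> real ^ 'm ^ 'p \<Rightarrow> ((real ^ 'n ^ 'n) \<times> (real ^ 'n ^ 'm)) set" where
  "Theta_H2 \<gamma> C D = {(Y, L). symmetric_mat Y \<and> trace (matrix_inv Y) < \<gamma>\<^sup>2 \<and>
     pd (Y - transpose (C_cl C D Y L) ** C_cl C D Y L)}"

definition M_H2 ::
  "real ^ 'n ^ 'p \<Rightarrow> real ^ 'm ^ 'p \<Rightarrow> (real ^ 'n ^ 'n) \<times> (real ^ 'n ^ 'm)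
    \<Rightarrow> real ^ ('n::finite + ('n + 'm::finite)) ^ ('n + ('n + 'm))" where
  "M_H2 C D = (\<lambda>(Y, L). block2
     Y 0
     0 (- (vstack Y L ** matrix_inv (Y - transpose (C_cl C D Y L) ** C_cl C D Y L) **
           transpose (vstack Y L))))"

lemma psd_congruence_matrix_inv:
  fixes S :: "real ^ 'n ^ 'n" and V :: "real ^ 'n ^ 'k"
  assumes "pd S"
  shows "psd (V ** matrix_inv S ** transpose V)"
proof -
  have sym: "transpose S = S" and pos: "\<And>v. v \<noteq> 0 \<Longrightarrow> 0 < v \<bullet> (S *v v)"
    using assms by (auto simp: pd_def symmetric_mat_def)
  have "invertible S"
    unfolding invertible_left_inverse matrix_left_invertible_ker using pos by force
  hence SI: "S ** matrix_inv S = mat 1" and IS: "matrix_inv S ** S = mat 1"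
    using someI_ex[of "\<lambda>S'. S ** S' = mat 1 \<and> S' ** S = mat 1"]
    by (auto simp: invertible_def matrix_inv_def)
  have "transpose (matrix_inv S) ** S = mat 1"
    using arg_cong[OF SI, of transpose] by (simp add: matrix_transpose_mul sym)
  hence symI: "transpose (matrix_inv S) = matrix_inv S"
    by (metis SI matrix_mul_assoc matrix_mul_lid matrix_mul_rid)
  have nonneg: "0 \<le> w \<bullet> (matrix_inv S *v w)" for w
  proof -
    define y where "y = matrix_inv S *v w"
    have "w = S *v y" by (simp add: y_def matrix_vector_mul_assoc SI)
    hence "w \<bullet> (matrix_inv S *v w) = y \<bullet> (S *v y)" by (simp add: y_def inner_commute)
    also have "\<dots> \<ge> 0" using pos[of y] by (cases "y = 0") auto
    finally show ?thesis .
  qed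
  have "v \<bullet> ((V ** matrix_inv S ** transpose V) *v v) =
      (transpose V *v v) \<bullet> (matrix_inv S *v (transpose V *v v))" for v
    by (simp add: dot_lmul_matrix flip: matrix_vector_mul_assoc)
  thus ?thesis
    using nonneg
    by (auto simp: psd_def symmetric_mat_def matrix_transpose_mul symI matrix_mul_assoc)
qed

lemma M_H2_admissible:
  assumes "\<theta> \<in> Theta_H2 \<gamma> C D"
  shows "symmetric_mat (M_H2 C D \<theta>) \<and> psd (- blk22 (M_H2 C D \<theta>))"
proof -
  obtain Y L where \<theta>: "\<theta> = (Y, L)" by (cases \<theta>)
  define R where "R = vstack Y L ** matrix_inv (Y - transpose (C_cl C D Y L) ** C_cl C D Y L) **
    transpose (vstack Y L)"
  have Y: "transpose Y = Y" and R: "psd R"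
    using assms psd_congruence_matrix_inv by (auto simp: Theta_H2_def \<theta> symmetric_mat_def R_def)
  have M: "M_H2 C D \<theta> = block2 Y 0 0 (- R)" by (simp add: M_H2_def \<theta> R_def)
  have "blk22 (M_H2 C D \<theta>) = - R"
    by (simp add: M blk22_def block2_def vstack_def hstack_def vec_eq_iff)
  moreover have "symmetric_mat (M_H2 C D \<theta>)"
    using Y R
    by (auto simp: M symmetric_mat_def psd_def transpose_def block2_def vstack_def hstack_def
        vec_eq_iff split: sum.split)
  ultimately show ?thesis using R by simp
qed

definition H2_LMIs ::
  "(nat \<Rightarrow> real ^ 'm) \<Rightarrow> (nat \<Rightarrow> real ^ 'n)
    \<Rightarrow> real ^ (1 + 't::{finite,linorder} \<times> 'n) ^ (1 + 't \<times> 'n) \<Rightarrow> real ^ 't::{finite,linorder} ^ 't::{finite,linorder}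
    \<Rightarrow> real \<Rightarrow> real ^ 'n ^ 'p \<Rightarrow> real ^ 'm ^ 'p
    \<Rightarrow> real ^ 'n ^ 'n \<Rightarrow> real ^ 'n ^ 'n \<Rightarrow> real ^ 'n ^ 'm \<Rightarrow> real \<Rightarrow> real \<Rightarrow> bool" where
  "H2_LMIs u x \<Phi> \<phi> \<gamma> C D Y Z L \<alpha> \<beta> \<longleftrightarrow>
     psd (col5
           (row5 (Y - \<beta> *\<^sub>R mat 1) 0 0             0            0)
           (row5 0                 0 0             Y            0)
           (row5 0                 0 0             L            0)
           (row5 0                 Y (transpose L) Y            (transpose (C_cl C D Y L)))
           (row5 0                 0 0             (C_cl C D Y L) (mat 1))
          - \<alpha> *\<^sub>R block2 (Q_mat u x \<Phi> \<phi>) 0 0 0) \<and>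
     pd (block2 Y (transpose (C_cl C D Y L)) (C_cl C D Y L) (mat 1)) \<and>
     psd (block2 Z (mat 1) (mat 1) Y) \<and>
     trace Z < \<gamma>\<^sup>2"

end

theory Submission
  imports Defs
begin

text \<open>
  Completing the square turns the noise inequality into the condition that \<open>Z = [A B]\<close> lies in a
  weighted Frobenius ball around some \<open>Z0\<close>; the inequality of \<open>Q\<close> describes the spectral ball with the
  same centre and radius. For a fixed vector \<open>v\<close> both balls yield the same vectors \<open>Z\<^sup>T v\<close>, because
  rank-one deviations suffice, so informativity is an implication between two quadratic forms in
  \<open>(v, Z\<^sup>T v)\<close>. The strict S-lemma supplies \<open>\<alpha>\<close> and \<open>\<beta>\<close>, and Schur complements give the linear matrix
  inequalities. For the closed loop, \<open>P = Y\<^sup>-\<^sup>1\<close> satisfies a strict Lyapunov inequality, whence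
  stability and the bound \<open>trace P\<close> for the squared H2 norm.
\<close>

section \<open>Quadratic forms\<close>

text \<open>Two degeneracies shape the argument. The block \<open>Q22\<close> may be singular, for
  instance when the stacked data matrix lacks full row rank. The compatible set, being nonempty, is
  then unbounded: the rows of \<open>[A B]\<close> can be moved along \<open>ker Q22\<close> freely.
  Both forms of the S-lemma vanish on \<open>{0} \<times> ker Q22\<close>, so no margin in the
  second argument can be expected; this is why \<beta> stands in the first diagonal block only. That
  the (2,2) block of \<open>M_H2\<close> vanishes on \<open>ker Q22\<close> is not assumed but
  forced by informativity, because an unbounded set of systems obeys a bound that is fixed for each
  \<open>v\<close>. This uses a nonnegative radius, which the true system provides. Secondly, the
  radius may be zero, and then the form of \<open>Q\<close> is nowhere positive. The S-lemma
  therefore cannot rely on a point where the constraint is strict; compactness of the unit sphere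
  bounds the multiplier instead.\<close>

lemma inner_matrix_vector_transpose:
  fixes A :: "real ^ 'c ^ 'r"
  shows "x \<bullet> (A *v y) = (transpose A *v x) \<bullet> y"
  by (simp add: transpose_matrix_vector dot_lmul_matrix)

lemma symmetric_mat_inner:
  assumes "symmetric_mat A"
  shows "x \<bullet> (A *v y) = y \<bullet> (A *v x)"
  using assms inner_matrix_vector_transpose[of x A y]
  by (simp add: symmetric_mat_def inner_commute)

lemma quad_form_add:
  assumes "symmetric_mat A"
  shows "(x + y) \<bullet> (A *v (x + y)) = x \<bullet> (A *v x) + 2 * (x \<bullet> (A *v y)) + y \<bullet> (A *v y)"
  using symmetric_mat_inner[OF assms, of x y]
  by (simp add: matrix_vector_right_distrib inner_add_left inner_add_right)

lemma quad_form_diff: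
  assumes "symmetric_mat A"
  shows "(x - y) \<bullet> (A *v (x - y)) = x \<bullet> (A *v x) - 2 * (x \<bullet> (A *v y)) + y \<bullet> (A *v y)"
  using symmetric_mat_inner[OF assms, of x y]
  by (simp add: matrix_vector_mult_diff_distrib inner_diff_left inner_diff_right)

lemma quad_form_scaleR:
  fixes A :: "real ^ 'n ^ 'n"
  shows "(c *\<^sub>R x) \<bullet> (A *v (c *\<^sub>R x)) = c\<^sup>2 * (x \<bullet> (A *v x))"
  by (simp add: matrix_vector_mult_scaleR power2_eq_square)

lemma quad_form_axis:
  fixes A :: "real ^ 'n ^ 'n"
  shows "axis j 1 \<bullet> (A *v axis j 1) = A $ j $ j"
  by (simp add: matrix_vector_mult_basis column_def inner_axis')

lemma continuous_on_quad_form [continuous_intros]: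
  fixes A :: "real ^ 'n ^ 'n"
  shows "continuous_on S (\<lambda>x. x \<bullet> (A *v x))"
  by (intro continuous_intros matrix_vector_mult_linear_continuous_on)

text \<open>Otherwise a small step from \<open>x\<close> along \<open>- (A *v x)\<close> would make
  the form negative.\<close>

lemma psd_quad_form_eq_0:
  assumes "psd A" "x \<bullet> (A *v x) = 0"
  shows "A *v x = 0"
proof -
  have sym: "symmetric_mat A" and nn: "\<And>v. 0 \<le> v \<bullet> (A *v v)"
    using assms(1) by (auto simp: psd_def)
  define y where "y = A *v x"
  define b where "b = y \<bullet> (A *v y)"
  \<comment> \<open>This step length keeps the quadratic term at most half of the linear one; the
    \<open>+ 1\<close> covers \<open>b = 0\<close>.\<close>
  define s where "s = y \<bullet> y / (b + 1)"
  have b: "b \<ge> 0" by (simp add: b_def nn)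
  have "0 \<le> (x - s *\<^sub>R y) \<bullet> (A *v (x - s *\<^sub>R y))" by (rule nn)
  also have "\<dots> = - 2 * s * (y \<bullet> y) + s\<^sup>2 * b"
    unfolding quad_form_diff[OF sym] quad_form_scaleR
    using assms(2) symmetric_mat_inner[OF sym, of x y]
    by (simp add: matrix_vector_mult_scaleR b_def y_def)
  finally have "2 * s * (y \<bullet> y) \<le> s * (s * b)" by (simp add: power2_eq_square mult.assoc)
  moreover have "s * b \<le> y \<bullet> y"
    using b by (simp add: s_def field_simps)
  moreover have "s \<ge> 0" using b by (simp add: s_def)
  ultimately have "2 * s * (y \<bullet> y) \<le> s * (y \<bullet> y)"
    by (meson mult_left_mono order_trans)
  hence "s * (y \<bullet> y) \<le> 0" by simp
  hence "(y \<bullet> y) * (y \<bullet> y) \<le> 0"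
    using b by (simp add: s_def divide_le_0_iff)
  hence "y = 0" by (metis inner_gt_zero_iff mult_pos_pos not_less)
  thus ?thesis by (simp add: y_def)
qed

text \<open>
  The Frobenius norm dominates the spectral norm: expand \<open>\<Sum>r. p (d r - (v r / \<bar>v\<bar>\<^sup>2) s) \<ge> 0\<close>
  for the form \<open>p\<close> of \<open>A\<close> and \<open>s = \<Sum>r. v r d r\<close>.
\<close>
lemma psd_form_sum_le:
  fixes d :: "'r::finite \<Rightarrow> real ^ 'k" and v :: "real ^ 'r"
  assumes "psd A"
  defines "s \<equiv> \<Sum>r\<in>UNIV. v $ r *\<^sub>R d r"
  shows "s \<bullet> (A *v s) \<le> (v \<bullet> v) * (\<Sum>r\<in>UNIV. d r \<bullet> (A *v d r))"
proof (cases "v = 0")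
  case True
  then show ?thesis by (simp add: s_def)
next
  case False
  hence pos: "v \<bullet> v > 0" by simp
  have sym: "symmetric_mat A" and nn: "\<And>v. 0 \<le> v \<bullet> (A *v v)"
    using assms(1) by (auto simp: psd_def)
  define t where "t = 1 / (v \<bullet> v)"
  have "0 \<le> (\<Sum>r\<in>UNIV. (d r - (t * v $ r) *\<^sub>R s) \<bullet> (A *v (d r - (t * v $ r) *\<^sub>R s)))"
    by (intro sum_nonneg nn)
  also have "\<dots> = (\<Sum>r\<in>UNIV. d r \<bullet> (A *v d r) - 2 * t * ((v $ r *\<^sub>R d r) \<bullet> (A *v s))
      + t\<^sup>2 * (v $ r * v $ r) * (s \<bullet> (A *v s)))"
    by (intro sum.cong refl, unfold quad_form_diff[OF sym] quad_form_scaleR)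
       (simp add: matrix_vector_mult_scaleR power2_eq_square)
  also have "\<dots> = (\<Sum>r\<in>UNIV. d r \<bullet> (A *v d r)) - 2 * t * (s \<bullet> (A *v s)) +
      t\<^sup>2 * (v \<bullet> v) * (s \<bullet> (A *v s))"
  proof -
    have "(\<Sum>r\<in>UNIV. (v $ r *\<^sub>R d r) \<bullet> (A *v s)) = s \<bullet> (A *v s)"
      unfolding s_def inner_sum_left ..
    moreover have "(\<Sum>r\<in>UNIV. v $ r * v $ r) = v \<bullet> v" by (simp add: inner_vec_def)
    ultimately show ?thesis
      by (simp only: sum.distrib sum_subtractf flip: sum_distrib_left sum_distrib_right)
  qed
  also have "\<dots> = (\<Sum>r\<in>UNIV. d r \<bullet> (A *v d r)) - t * (s \<bullet> (A *v s))"
    using pos by (simp add: t_def power2_eq_square)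
  finally show ?thesis
    using pos by (simp add: t_def field_simps)
qed

section \<open>Positive definite matrices and their inverses\<close>

lemma pd_imp_psd: "pd A \<Longrightarrow> psd A"
  unfolding pd_def psd_def by (metis inner_zero_left less_imp_le order_refl)

text \<open>The form attains its minimum on the compact unit sphere, and homogeneity does the rest.
  It gives the strict Lyapunov inequality a uniform margin.\<close>

lemma pd_lower_bound:
  fixes A :: "real ^ 'n ^ 'n"
  assumes pos: "\<And>x. x \<noteq> 0 \<Longrightarrow> 0 < x \<bullet> (A *v x)"
  obtains c where "c > 0" "\<And>x. c * (x \<bullet> x) \<le> x \<bullet> (A *v x)"
proof -
  have "\<exists>z\<in>sphere 0 1. \<forall>y\<in>sphere 0 1. z \<bullet> (A *v z) \<le> y \<bullet> (A *v y)"
    by (rule continuous_attains_inf) (auto intro: continuous_on_quad_form)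
  then obtain z where z: "norm z = 1" "\<And>y. norm y = 1 \<Longrightarrow> z \<bullet> (A *v z) \<le> y \<bullet> (A *v y)"
    by auto
  show ?thesis
  proof
    show "0 < z \<bullet> (A *v z)" using z(1) by (intro pos) auto
    show "z \<bullet> (A *v z) * (x \<bullet> x) \<le> x \<bullet> (A *v x)" for x
    proof (cases "x = 0")
      case False
      let ?y = "(1 / norm x) *\<^sub>R x"
      have "z \<bullet> (A *v z) \<le> ?y \<bullet> (A *v ?y)" using False by (intro z(2)) auto
      also have "\<dots> = (x \<bullet> (A *v x)) / (x \<bullet> x)"
        unfolding quad_form_scaleR by (simp add: power_one_over dot_square_norm)
      finally show ?thesis using False by (simp add: field_simps)
    qed simp
  qed
qed

lemma invertible_matrix_inv:
  assumes "invertible A"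
  shows "A ** matrix_inv A = mat 1" "matrix_inv A ** A = mat 1"
  using assms someI_ex[of "\<lambda>X. A ** X = mat 1 \<and> X ** A = mat 1"]
  by (auto simp: invertible_def matrix_inv_def)

text \<open>For the inverse, congruence gives semidefiniteness; a semidefinite form vanishes only on
  the kernel, which is trivial here.\<close>

lemma pd_matrix_inv:
  fixes A :: "real ^ 'n ^ 'n"
  assumes "pd A"
  shows "A ** matrix_inv A = mat 1" "matrix_inv A ** A = mat 1" "pd (matrix_inv A)"
proof -
  have "invertible A"
    unfolding invertible_left_inverse matrix_left_invertible_ker using assms
    by (force simp: pd_def)
  thus 1: "A ** matrix_inv A = mat 1" and 2: "matrix_inv A ** A = mat 1"
    by (rule invertible_matrix_inv)+
  have "psd (matrix_inv A)"
    using psd_congruence_matrix_inv[OF assms, of "mat 1"] by simp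
  moreover have "matrix_inv A *v x = 0 \<Longrightarrow> x = 0" for x
    using 1 by (metis matrix_vector_mul_assoc matrix_vector_mul_lid matrix_vector_mult_0_right)
  ultimately show "pd (matrix_inv A)"
    using psd_quad_form_eq_0 unfolding pd_def psd_def by (metis order_le_less)
qed

lemma matrix_inv_mult_vec:
  fixes A :: "real ^ 'n ^ 'n"
  assumes "pd A"
  shows "A *v (matrix_inv A *v x) = x" "matrix_inv A *v (A *v x) = x"
  by (simp_all add: matrix_vector_mul_assoc pd_matrix_inv[OF assms])

text \<open>The minimum over \<open>b\<close> is attained at
  \<open>b = - (matrix_inv S *v r)\<close>. The identity drives the Schur complements with respect
  to \<open>Y\<close> and \<open>S\<close> and the dualization of the closed loop.\<close>

lemma pd_complete_square:
  assumes "pd S"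
  shows "2 * (r \<bullet> b) + b \<bullet> (S *v b) =
    (b + matrix_inv S *v r) \<bullet> (S *v (b + matrix_inv S *v r)) - r \<bullet> (matrix_inv S *v r)"
proof -
  have sym: "symmetric_mat S" using assms by (simp add: pd_def)
  show ?thesis
    unfolding quad_form_add[OF sym] matrix_inv_mult_vec[OF assms]
    by (simp add: inner_commute)
qed

section \<open>The strict homogeneous S-lemma\<close>

text \<open>
  On the plane through \<open>x\<close> and \<open>y\<close> the form \<open>g\<close> vanishes on two lines, spanned by \<open>x + s y\<close> and
  \<open>x + t y\<close> with \<open>s t = g x / g y\<close>; averaging the values of \<open>f\<close> there eliminates its mixed term.
\<close>
lemma S_lemma_plane:
  fixes F G :: "real ^ 'k ^ 'k"
  assumes sym: "symmetric_mat F" "symmetric_mat G"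
    and x: "x \<bullet> (G *v x) > 0" and y: "y \<bullet> (G *v y) < 0"
    and pos: "\<And>t. (x + t *\<^sub>R y) \<bullet> (G *v (x + t *\<^sub>R y)) = 0 \<Longrightarrow>
                  (x + t *\<^sub>R y) \<bullet> (F *v (x + t *\<^sub>R y)) > 0"
  shows "(y \<bullet> (F *v y)) / (y \<bullet> (G *v y)) < (x \<bullet> (F *v x)) / (x \<bullet> (G *v x))"
proof -
  define a b c where "a = x \<bullet> (G *v x)" and "b = x \<bullet> (G *v y)" and "c = - (y \<bullet> (G *v y))"
  define a' b' c' where "a' = x \<bullet> (F *v x)" and "b' = x \<bullet> (F *v y)" and "c' = y \<bullet> (F *v y)"
  have ac: "a > 0" "c > 0" using x y by (auto simp: a_def c_def)
  have g: "(x + t *\<^sub>R y) \<bullet> (G *v (x + t *\<^sub>R y)) = a + 2 * t * b - t\<^sup>2 * c" for t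
    unfolding quad_form_add[OF sym(2)] quad_form_scaleR
    by (simp add: a_def b_def c_def matrix_vector_mult_scaleR)
  have f: "(x + t *\<^sub>R y) \<bullet> (F *v (x + t *\<^sub>R y)) = a' + 2 * t * b' + t\<^sup>2 * c'" for t
    unfolding quad_form_add[OF sym(1)] quad_form_scaleR
    by (simp add: a'_def b'_def c'_def matrix_vector_mult_scaleR)
  \<comment> \<open>Both roots of \<open>a + 2 t b - t\<^sup>2 c\<close> are
    \<open>(b - w) / c\<close> and \<open>(b + w) / c\<close>. Since \<open>a c > 0\<close>,
    \<open>w\<close> exceeds \<open>\<bar>b\<bar>\<close>, so \<open>s < 0 < t\<close> and the
    averaging weights \<open>t\<close> and \<open>- s\<close> are positive.\<close>
  define w where "w = sqrt (b\<^sup>2 + a * c)"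
  have w2: "w\<^sup>2 = b\<^sup>2 + a * c" using ac by (simp add: w_def)
  have w: "w > \<bar>b\<bar>"
    unfolding w_def using ac by (simp add: real_less_rsqrt)
  define s t where "s = (b - w) / c" and "t = (b + w) / c"
  have s: "s < 0" and t: "t > 0" using w ac by (auto simp: s_def t_def field_simps)
  have "a + 2 * s * b - s\<^sup>2 * c = (a * c + b\<^sup>2 - w\<^sup>2) / c"
       "a + 2 * t * b - t\<^sup>2 * c = (a * c + b\<^sup>2 - w\<^sup>2) / c"
    using ac by (simp_all add: s_def t_def field_simps power2_eq_square)
  hence "a + 2 * s * b - s\<^sup>2 * c = 0" "a + 2 * t * b - t\<^sup>2 * c = 0"
    by (simp_all add: w2)
  hence fs: "a' + 2 * s * b' + s\<^sup>2 * c' > 0" and ft: "a' + 2 * t * b' + t\<^sup>2 * c' > 0"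
    using pos g f by metis+
  have st: "s * t = - a / c"
  proof -
    have "s * t = (b\<^sup>2 - w\<^sup>2) / (c * c)" by (simp add: s_def t_def field_simps power2_eq_square)
    also have "\<dots> = - a / c" using ac by (simp add: w2 field_simps)
    finally show ?thesis .
  qed
  have "0 < t * (a' + 2 * s * b' + s\<^sup>2 * c') + (- s) * (a' + 2 * t * b' + t\<^sup>2 * c')"
    using mult_pos_pos[OF t fs] mult_pos_pos[OF _ ft, of "- s"] s by linarith
  also have "\<dots> = (t - s) * (a' - s * t * c')" by (simp add: algebra_simps power2_eq_square)
  finally have "0 < (t - s) * (a' + a / c * c')" unfolding st by simp
  hence "0 < a' + a / c * c'" using s t by (simp add: zero_less_mult_iff)
  hence "- c' / c < a' / a" using ac by (simp add: field_simps)
  thus ?thesis by (simp add: a_def a'_def c_def c'_def)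
qed

text \<open>A multiplier must satisfy \<alpha> \<le> f/g where g > 0 and \<alpha> \<ge> f/g where g
  < 0. By \<open>S_lemma_plane\<close> every lower bound lies below every upper bound, so the
  supremum of the lower bounds works. A multiple of the identity is subtracted from \<open>F\<close>
  beforehand and becomes the margin \<open>c\<close>.\<close>

lemma strict_S_lemma:
  fixes F G :: "real ^ 'k ^ 'k"
  assumes sym: "symmetric_mat F" "symmetric_mat G" and S: "subspace S"
    and pos: "\<And>x. x \<in> S \<Longrightarrow> x \<noteq> 0 \<Longrightarrow> x \<bullet> (G *v x) \<ge> 0 \<Longrightarrow> x \<bullet> (F *v x) > 0"
  obtains \<alpha> c where "\<alpha> \<ge> 0" "c > 0"
    "\<And>x. x \<in> S \<Longrightarrow> c * (x \<bullet> x) \<le> x \<bullet> (F *v x) - \<alpha> * (x \<bullet> (G *v x))"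
proof (cases "S \<subseteq> {0}")
  case True
  with that[of 0 1] show ?thesis by force
next
  case False
  define K where "K = S \<inter> sphere 0 1"
  have "compact K"
    unfolding K_def using closed_subspace[OF S] by (simp add: closed_Int_compact)
  have K: "x \<in> S" "norm x = 1" "x \<noteq> 0" if "x \<in> K" for x using that by (auto simp: K_def)
  obtain x0 where x0: "x0 \<in> S" "x0 \<noteq> 0" using False by auto
  hence "(1 / norm x0) *\<^sub>R x0 \<in> K" using S by (auto simp: K_def subspace_scale)
  hence "K \<noteq> {}" by blast
  define f g where "f = (\<lambda>x. x \<bullet> (F *v x))" and "g = (\<lambda>x. x \<bullet> (G *v x))"
  have cont: "continuous_on K f" "continuous_on K g"
    unfolding f_def g_def by (rule continuous_on_quad_form)+
  \<comment> \<open>The maximum of \<open>f\<close> and \<open>- g\<close> is positive on all of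
    \<open>K\<close>, because \<open>f > 0\<close> wherever \<open>g \<ge> 0\<close>. Its minimum
    quantifies this: at each unit vector of \<open>S\<close> either \<open>f\<close> or
    \<open>- g\<close> is at least \<open>2 * \<delta>\<close>.\<close>
  have "\<exists>z\<in>K. \<forall>y\<in>K. max (f z) (- g z) \<le> max (f y) (- g y)"
    using \<open>compact K\<close> \<open>K \<noteq> {}\<close> cont
    by (intro continuous_attains_inf continuous_intros)
  then obtain z where z: "z \<in> K" "\<And>y. y \<in> K \<Longrightarrow> max (f z) (- g z) \<le> max (f y) (- g y)"
    by auto
  define \<delta> where "\<delta> = max (f z) (- g z) / 2"
  have \<delta>: "\<delta> > 0"
    using pos[of z] K[OF z(1)] by (cases "g z \<ge> 0") (auto simp: \<delta>_def f_def g_def less_max_iff_disj)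
  have dich: "f y \<ge> 2 * \<delta> \<or> - g y \<ge> 2 * \<delta>" if "y \<in> K" for y
    using z(2)[OF that] by (auto simp: \<delta>_def max_def split: if_splits)
  \<comment> \<open>Only half of the margin is spent, so the hypothesis on \<open>F\<close> still
    holds strictly for \<open>F'\<close>.\<close>
  define F' where "F' = F - \<delta> *\<^sub>R mat 1"
  define f' where "f' = (\<lambda>x. x \<bullet> (F' *v x))"
  have f': "f' x = f x - \<delta> * (x \<bullet> x)" for x
    by (simp add: f'_def F'_def f_def matrix_vector_mult_diff_rdistrib inner_diff_right
        flip: scaleR_matrix_vector_assoc)
  have symF': "symmetric_mat F'"
    using sym by (simp add: F'_def symmetric_mat_def transpose_def vec_eq_iff mat_def)
  have pos': "f' x > 0" if "x \<in> S" "x \<noteq> 0" "g x \<ge> 0" for x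
  proof -
    define y where "y = (1 / norm x) *\<^sub>R x"
    have "y \<in> K" using that S by (auto simp: y_def K_def subspace_scale)
    have sc: "f' y = (1 / norm x)\<^sup>2 * f' x" "g y = (1 / norm x)\<^sup>2 * g x"
      unfolding y_def f'_def g_def by (rule quad_form_scaleR)+
    have "g y \<ge> 0" using that(3) by (simp add: sc)
    hence "f y \<ge> 2 * \<delta>" using dich[OF \<open>y \<in> K\<close>] \<delta> by auto
    moreover have "y \<bullet> y = 1" using K(2)[OF \<open>y \<in> K\<close>] by (simp add: dot_square_norm)
    ultimately have "f' y > 0" using \<delta> by (simp add: f')
    thus ?thesis using that(2) by (simp add: sc zero_less_mult_iff)
  qed
  obtain m where m: "\<And>y. y \<in> K \<Longrightarrow> - f' y \<le> m" "m \<ge> 0"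
  proof -
    have "\<exists>z\<in>K. \<forall>y\<in>K. - f' y \<le> - f' z"
      using \<open>compact K\<close> \<open>K \<noteq> {}\<close> unfolding f'_def
      by (intro continuous_attains_sup continuous_intros)
    then obtain z where "\<And>y. y \<in> K \<Longrightarrow> - f' y \<le> - f' z" by auto
    thus ?thesis using that[of "max 0 (- f' z)"] by (simp add: max.coboundedI2)
  qed
  \<comment> \<open>These are the lower bounds for the multiplier; inserting 0 makes it nonnegative
    and keeps the set nonempty.\<close>
  define R where "R = insert 0 {f' y / g y | y. y \<in> K \<and> g y < 0}"
  \<comment> \<open>There may be no vector with \<open>g > 0\<close> to bound \<open>R\<close> from
    above. Quotients with \<open>g\<close> close to 0 are harmless: the dichotomy makes
    \<open>f'\<close> positive there, hence the quotient negative; otherwise the denominator is at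
    least \<open>2 * \<delta>\<close> in modulus.\<close>
  have bdd: "r \<le> m / (2 * \<delta>)" if "r \<in> R" for r
  proof (cases "r = 0")
    case True
    then show ?thesis using m \<delta> by simp
  next
    case False
    then obtain y where y: "y \<in> K" "g y < 0" "r = f' y / g y"
      using \<open>r \<in> R\<close> by (auto simp: R_def)
    show ?thesis
    proof (cases "f y \<ge> 2 * \<delta>")
      case True
      hence "f' y > 0" using K(2)[OF y(1)] \<delta> by (simp add: f' dot_square_norm)
      hence "r \<le> 0" using y by (simp add: divide_nonneg_neg)
      also have "\<dots> \<le> m / (2 * \<delta>)" using m(2) \<delta> by simp
      finally show ?thesis .
    next
      case False
      hence "- g y \<ge> 2 * \<delta>" using dich[OF y(1)] by auto
      hence "- f' y / - g y \<le> m / (2 * \<delta>)"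
        using m(1)[OF y(1)] m(2) \<delta> by (intro frac_le) auto
      thus ?thesis by (simp add: y)
    qed
  qed
  have R_le: "r \<le> f' x / g x" if "r \<in> R" "x \<in> S" "g x > 0" for r x
  proof (cases "r = 0")
    case True
    have "x \<noteq> 0" using that(3) by (auto simp: g_def)
    then show ?thesis using pos'[of x] that True by auto
  next
    case False
    then obtain y where y: "y \<in> K" "g y < 0" "r = f' y / g y"
      using \<open>r \<in> R\<close> by (auto simp: R_def)
    have "(x + t *\<^sub>R y) \<bullet> (F' *v (x + t *\<^sub>R y)) > 0"
      if "(x + t *\<^sub>R y) \<bullet> (G *v (x + t *\<^sub>R y)) = 0" for t
    proof -
      have "x + t *\<^sub>R y \<in> S" using K(1)[OF y(1)] \<open>x \<in> S\<close> S by (simp add: subspace_add subspace_scale)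
      moreover have "x + t *\<^sub>R y \<noteq> 0"
      proof
        assume "x + t *\<^sub>R y = 0"
        hence "x = (- t) *\<^sub>R y" by (simp add: eq_neg_iff_add_eq_0)
        hence "g x = t\<^sup>2 * g y" by (simp only: g_def quad_form_scaleR power2_minus)
        also have "\<dots> \<le> 0" using y(2) by (simp add: mult_nonneg_nonpos)
        finally show False using \<open>g x > 0\<close> by simp
      qed
      ultimately show ?thesis using pos'[of "x + t *\<^sub>R y"] that by (simp add: f'_def g_def)
    qed
    thus ?thesis
      using S_lemma_plane[OF symF' sym(2), of x y] y \<open>g x > 0\<close>
      by (simp add: f'_def g_def less_imp_le)
  qed
  define \<alpha> where "\<alpha> = Sup R"
  have "bdd_above R" using bdd by (meson bdd_aboveI)
  hence up: "r \<le> \<alpha>" if "r \<in> R" for r unfolding \<alpha>_def using that by (rule cSup_upper[rotated])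
  have "\<alpha> \<ge> 0" by (rule up) (simp add: R_def)
  moreover have "0 \<le> f' x - \<alpha> * g x" if x: "x \<in> S" for x
  proof (cases "x = 0")
    case True
    then show ?thesis by (simp add: f'_def g_def)
  next
    case nz: False
    consider "g x > 0" | "g x = 0" | "g x < 0" by linarith
    thus ?thesis
    proof cases
      case 1
      hence "\<alpha> \<le> f' x / g x"
        unfolding \<alpha>_def using R_le[OF _ x] by (intro cSup_least) (auto simp: R_def)
      thus ?thesis using 1 by (simp add: field_simps)
    next
      case 2
      thus ?thesis using pos'[OF x nz] by simp
    next
      case 3
      define y where "y = (1 / norm x) *\<^sub>R x"
      have "y \<in> K" using nz x S by (auto simp: y_def K_def subspace_scale)
      have sc: "f' y = (1 / norm x)\<^sup>2 * f' x" "g y = (1 / norm x)\<^sup>2 * g x"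
        unfolding y_def f'_def g_def by (rule quad_form_scaleR)+
      have "g y < 0" using 3 nz by (simp add: sc mult_pos_neg)
      hence "f' y / g y \<le> \<alpha>" using \<open>y \<in> K\<close> by (intro up) (auto simp: R_def)
      hence "f' x / g x \<le> \<alpha>" using nz by (simp add: sc)
      thus ?thesis using 3 by (simp add: field_simps)
    qed
  qed
  ultimately show ?thesis
    using that[of \<alpha> \<delta>] \<delta> by (simp add: f' f_def g_def algebra_simps)
qed

section \<open>The pseudoinverse\<close>

lemma inner_inverse_exists:
  fixes A :: "real ^ 'c ^ 'r"
  obtains X where "A ** X ** A = A"
proof -
  obtain g where g: "linear g" "\<And>v. v \<in> range ((*v) A) \<Longrightarrow> A *v g v = v"
    using linear_exists_right_inverse_on[OF matrix_vector_mul_linear[of A] subspace_UNIV] by blast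
  have "(A ** matrix g ** A) *v x = A *v x" for x
    using g(2)[of "A *v x"] matrix_works[of g "A *v x"] g(1)
    by (simp flip: matrix_vector_mul_assoc)
  hence "A ** matrix g ** A = A" by (simp add: matrix_eq)
  thus ?thesis by (rule that)
qed

lemma gram_cancel_left:
  fixes A :: "real ^ 'c ^ 'r"
  assumes "transpose A ** A ** X = transpose A ** A ** Y"
  shows "A ** X = A ** Y"
proof -
  have "A *v (X *v x - Y *v x) = 0" for x
  proof -
    let ?d = "X *v x - Y *v x"
    have "transpose A *v (A *v ?d) = 0"
      using arg_cong[OF assms, of "\<lambda>M. M *v x"]
      by (simp add: matrix_vector_mult_diff_distrib flip: matrix_vector_mul_assoc)
    hence "(A *v ?d) \<bullet> (A *v ?d) = 0"
      by (simp add: inner_matrix_vector_transpose)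
    thus ?thesis by simp
  qed
  thus ?thesis
    by (simp add: matrix_eq matrix_vector_mult_diff_distrib flip: matrix_vector_mul_assoc)
qed

text \<open>With \<open>H\<close> an inner inverse of the Gram matrix of \<open>A\<close>, take
  \<open>X = H ** transpose A\<close>, the solution operator of the normal equations;
  \<open>A ** X\<close> is then the orthogonal projection onto the range of
  \<open>A\<close>.\<close>

lemma least_squares_inverse_exists:
  fixes A :: "real ^ 'c ^ 'r"
  obtains X where "A ** X ** A = A" "transpose (A ** X) = A ** X"
proof -
  let ?T = "transpose A"
  obtain H where H: "(?T ** A) ** H ** (?T ** A) = ?T ** A" using inner_inverse_exists .
  have 1: "A ** H ** ?T ** A = A"
    using gram_cancel_left[of A "H ** ?T ** A" "mat 1"] H by (simp add: matrix_mul_assoc)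
  hence 2: "?T ** A ** transpose H ** ?T = ?T"
    by (metis matrix_mul_assoc matrix_transpose_mul transpose_transpose)
  have "A ** H ** ?T = A ** H ** (?T ** A ** transpose H ** ?T)" by (simp only: 2)
  also have "\<dots> = (A ** H ** ?T ** A) ** transpose H ** ?T" by (simp add: matrix_mul_assoc)
  also have "\<dots> = transpose (A ** H ** ?T)" by (simp add: 1 matrix_transpose_mul matrix_mul_assoc)
  finally show ?thesis using 1 that[of "H ** ?T"] by (simp add: matrix_mul_assoc)
qed

text \<open>\<open>pinv\<close> is a definite description, so even a single Penrose equation
  requires existence and uniqueness of the solution of all four.\<close>

lemma pinv_inner_inverse:
  fixes A :: "real ^ 'c ^ 'r"
  shows "A ** pinv A ** A = A"
proof -
  let ?P = "\<lambda>Y. A ** Y ** A = A \<and> Y ** A ** Y = Y \<and>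
     transpose (A ** Y) = A ** Y \<and> transpose (Y ** A) = Y ** A"
  obtain X1 where X1: "A ** X1 ** A = A" "transpose (A ** X1) = A ** X1"
    using least_squares_inverse_exists .
  obtain V where V: "transpose A ** V ** transpose A = transpose A"
      "transpose (transpose A ** V) = transpose A ** V"
    using least_squares_inverse_exists .
  define X2 where "X2 = transpose V"
  have X2: "A ** X2 ** A = A" "transpose (X2 ** A) = X2 ** A"
    using arg_cong[OF V(1), of transpose] V(2)
    by (simp_all add: X2_def matrix_transpose_mul matrix_mul_assoc)
  \<comment> \<open>\<open>X1\<close> has the symmetric product on the left of
    \<open>A\<close>-multiplication, \<open>X2\<close> the one on the right; the combination
    \<open>X2 ** A ** X1\<close> inherits both.\<close>
  have "A ** (X2 ** A ** X1) = A ** X1" "(X2 ** A ** X1) ** A = X2 ** A"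
    by (metis X2(1) matrix_mul_assoc, metis X1(1) matrix_mul_assoc)
  moreover have "(X2 ** A ** X1) ** A ** (X2 ** A ** X1) = X2 ** A ** X1"
    by (metis X1(1) X2(1) matrix_mul_assoc)
  ultimately have ex: "?P (X2 ** A ** X1)"
    using X1 X2 by simp
  have uniq: "X = Y" if "?P X" "?P Y" for X Y
  proof -
    have "A ** X = A ** Y ** (A ** X)" using that by (metis matrix_mul_assoc)
    also have "\<dots> = transpose (A ** X ** (A ** Y))" using that by (metis matrix_transpose_mul)
    also have "\<dots> = A ** Y" using that by (metis matrix_mul_assoc)
    finally have AX: "A ** X = A ** Y" .
    have "X ** A = X ** A ** (Y ** A)" using that by (metis matrix_mul_assoc)
    also have "\<dots> = transpose (Y ** A ** (X ** A))" using that by (metis matrix_transpose_mul)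
    also have "\<dots> = Y ** A" using that by (metis matrix_mul_assoc)
    finally have XA: "X ** A = Y ** A" .
    have "X = X ** A ** X" using that by simp
    also have "\<dots> = Y ** A ** Y" using AX XA by (metis matrix_mul_assoc)
    also have "\<dots> = Y" using that by simp
    finally show ?thesis .
  qed
  have "?P (pinv A)" unfolding pinv_def by (rule theI[of ?P, OF ex]) (rule uniq[OF _ ex])
  thus ?thesis by blast
qed

section \<open>Stability and the H2 norm from a Lyapunov inequality\<close>

text \<open>Complex vectors are split so that real forms apply: for real symmetric \<open>P\<close>
  the Hermitian form of \<open>P\<close> is the sum of its values at the real and imaginary
  parts.\<close>

definition re_vec :: "complex ^ 'n \<Rightarrow> real ^ 'n" where
  "re_vec y = (\<chi> i. Re (y $ i))"

definition im_vec :: "complex ^ 'n \<Rightarrow> real ^ 'n" where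
  "im_vec y = (\<chi> i. Im (y $ i))"

lemma complex_vec_eq_iff: "y = y' \<longleftrightarrow> re_vec y = re_vec y' \<and> im_vec y = im_vec y'"
  by (auto simp: re_vec_def im_vec_def vec_eq_iff complex_eq_iff)

lemma re_im_vec_add_diff [simp]:
  "re_vec (y - y') = re_vec y - re_vec y'" "im_vec (y - y') = im_vec y - im_vec y'"
  "re_vec 0 = 0" "im_vec 0 = 0"
  by (simp_all add: re_vec_def im_vec_def vec_eq_iff)

lemma re_im_vec_complex_mat [simp]:
  "re_vec (complex_mat A *v y) = A *v re_vec y"
  "im_vec (complex_mat A *v y) = A *v im_vec y"
  by (simp_all add: re_vec_def im_vec_def vec_eq_iff complex_mat_def map_matrix_def
      matrix_vector_mult_def)

lemma re_im_vec_smult [simp]: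
  "re_vec (z *s y) = Re z *\<^sub>R re_vec y - Im z *\<^sub>R im_vec y"
  "im_vec (z *s y) = Re z *\<^sub>R im_vec y + Im z *\<^sub>R re_vec y"
  by (simp_all add: re_vec_def im_vec_def vec_eq_iff)

lemma re_im_vec_axis [simp]:
  "re_vec (axis j 1) = axis j 1" "im_vec (axis j 1) = 0"
  by (simp_all add: re_vec_def im_vec_def vec_eq_iff axis_def)

lemma sum_norm_power2_complex_vec:
  fixes y :: "complex ^ 'n"
  shows "(\<Sum>i\<in>UNIV. (norm (y $ i))\<^sup>2) = re_vec y \<bullet> re_vec y + im_vec y \<bullet> im_vec y"
  unfolding cmod_power2 sum.distrib
  by (simp add: re_vec_def im_vec_def inner_vec_def power2_eq_square)

text \<open>The two arguments on the left are the real and imaginary parts of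
  \<open>(c + i s) (a + i b)\<close>, and a Hermitian form scales with the squared modulus.\<close>

lemma quad_form_rotate:
  assumes "symmetric_mat P"
  shows "(c *\<^sub>R a - s *\<^sub>R b) \<bullet> (P *v (c *\<^sub>R a - s *\<^sub>R b)) +
         (c *\<^sub>R b + s *\<^sub>R a) \<bullet> (P *v (c *\<^sub>R b + s *\<^sub>R a)) =
         (c\<^sup>2 + s\<^sup>2) * (a \<bullet> (P *v a) + b \<bullet> (P *v b))"
  unfolding quad_form_add[OF assms] quad_form_diff[OF assms] quad_form_scaleR
  using symmetric_mat_inner[OF assms, of a b]
  by (simp add: matrix_vector_mult_scaleR algebra_simps)

lemma mat_vector_mult: "mat z *v y = z *s y" for z :: "'a::comm_semiring_1"
  by (simp add: mat_def matrix_vector_mult_def vec_eq_iff if_distrib[of "\<lambda>a. a * _"] cong: if_cong)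

lemma integral_cos_period:
  "((\<lambda>t. cos (real k * t)) has_integral (if k = 0 then 2 * pi else 0)) {- pi..pi}"
proof (cases "k = 0")
  case True
  then show ?thesis using has_integral_const_real[of "1::real" "- pi" pi] by simp
next
  case False
  have "((\<lambda>t. cos (real k * t)) has_integral
      (sin (real k * pi) / real k - sin (real k * - pi) / real k)) {- pi..pi}"
    using False
    by (intro fundamental_theorem_of_calculus)
       (auto intro!: derivative_eq_intros simp flip: has_real_derivative_iff_has_vector_derivative)
  then show ?thesis using False by (simp add: sin_npi)
qed

text \<open>\<open>P\<close> strictly satisfies the inequality whose equality case defines the
  observability Gramian. It therefore dominates the Gramian, whose trace is the squared H2
  norm.\<close>

context
  fixes P A :: "real ^ 'n ^ 'n" and C :: "real ^ 'n ^ 'p"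
  assumes P: "pd P"
    and lyapunov: "\<And>x. x \<noteq> 0 \<Longrightarrow>
      (A *v x) \<bullet> (P *v (A *v x)) + (C *v x) \<bullet> (C *v x) < x \<bullet> (P *v x)"
begin

private lemma symP: "symmetric_mat P"
  using P by (simp add: pd_def)

private lemma nnP: "0 \<le> x \<bullet> (P *v x)"
  using pd_imp_psd[OF P] by (simp add: psd_def)

text \<open>Along an eigenvector \<open>A\<close> multiplies the Hermitian form of \<open>P\<close>
  by \<open>(cmod z)\<^sup>2\<close>, while the hypothesis makes the form decrease strictly.\<close>

lemma lyapunov_imp_schur_stable: "schur_stable A"
  unfolding schur_stable_def
proof (intro allI impI, elim conjE)
  fix z :: complex and v
  assume v: "v \<noteq> 0" "complex_mat A *v v = z *s v"
  define a b where "a = re_vec v" and "b = im_vec v"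
  have A: "A *v a = Re z *\<^sub>R a - Im z *\<^sub>R b" "A *v b = Re z *\<^sub>R b + Im z *\<^sub>R a"
    using arg_cong[OF v(2), of re_vec] arg_cong[OF v(2), of im_vec]
    by (simp_all add: a_def b_def)
  have le: "(A *v x) \<bullet> (P *v (A *v x)) \<le> x \<bullet> (P *v x)" for x
    using lyapunov[of x] inner_ge_zero[of "C *v x"] by (cases "x = 0") (simp, linarith)
  have less: "(A *v x) \<bullet> (P *v (A *v x)) < x \<bullet> (P *v x)" if "x \<noteq> 0" for x
    using lyapunov[OF that] inner_ge_zero[of "C *v x"] by linarith
  have "a \<noteq> 0 \<or> b \<noteq> 0" using v(1) by (simp add: complex_vec_eq_iff a_def b_def)
  hence "(A *v a) \<bullet> (P *v (A *v a)) + (A *v b) \<bullet> (P *v (A *v b)) <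
      a \<bullet> (P *v a) + b \<bullet> (P *v b)"
    using le[of a] le[of b] less[of a] less[of b] by linarith
  hence "(cmod z)\<^sup>2 * (a \<bullet> (P *v a) + b \<bullet> (P *v b)) < a \<bullet> (P *v a) + b \<bullet> (P *v b)"
    unfolding A quad_form_rotate[OF symP] cmod_power2 .
  moreover have "0 \<le> a \<bullet> (P *v a) + b \<bullet> (P *v b)" using nnP by simp
  ultimately have "(cmod z)\<^sup>2 < 1"
    by (metis mult_le_cancel_right1 not_less)
  thus "cmod z < 1" by (simp add: power_less_one_iff abs_square_less_1)
qed

private lemma lyapunov_bound:
  obtains \<delta> where "\<delta> > 0"
    "\<And>x. \<delta> * (x \<bullet> x) + (A *v x) \<bullet> (P *v (A *v x)) + (C *v x) \<bullet> (C *v x) \<le> x \<bullet> (P *v x)"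
proof -
  let ?M = "P - transpose A ** P ** A - transpose C ** C"
  have M: "x \<bullet> (?M *v x) = x \<bullet> (P *v x) - (A *v x) \<bullet> (P *v (A *v x)) - (C *v x) \<bullet> (C *v x)" for x
    unfolding matrix_vector_mult_diff_rdistrib inner_diff_right matrix_vector_mul_assoc[symmetric]
      inner_matrix_vector_transpose[of x "transpose _"] transpose_transpose ..
  have "0 < x \<bullet> (?M *v x)" if "x \<noteq> 0" for x
    using lyapunov[OF that] by (simp add: M)
  from pd_lower_bound[OF this] obtain c where
    "c > 0" "\<And>x. c * (x \<bullet> x) \<le> x \<bullet> (?M *v x)" by blast
  thus ?thesis using that[of c] unfolding M by (simp add: algebra_simps)
qed

text \<open>The energy lost along a trajectory telescopes: \<delta> times the sum of the squared
  norms stays below the initial value of the form, so the terms tend to 0.\<close>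

private lemma power_mult_tendsto_0: "(\<lambda>N. (((*v) A) ^^ N) x) \<longlonglongrightarrow> 0"
proof -
  obtain \<delta> where \<delta>: "\<delta> > 0"
    "\<And>x. \<delta> * (x \<bullet> x) + (A *v x) \<bullet> (P *v (A *v x)) + (C *v x) \<bullet> (C *v x) \<le> x \<bullet> (P *v x)"
    using lyapunov_bound by blast
  define y where "y = (\<lambda>N. (((*v) A) ^^ N) x)"
  have telescope: "(\<Sum>k<N. \<delta> * (y k \<bullet> y k)) + y N \<bullet> (P *v y N) \<le> x \<bullet> (P *v x)" for N
  proof (induction N)
    case (Suc N)
    have y_Suc: "y (Suc N) = A *v y N" by (simp add: y_def)
    show ?case
      using Suc \<delta>(2)[of "y N"] inner_ge_zero[of "C *v y N"]
      unfolding sum.lessThan_Suc y_Suc by linarith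
  qed (simp add: y_def)
  have "(\<Sum>k<N. \<delta> * (y k \<bullet> y k)) \<le> x \<bullet> (P *v x)" for N
    using telescope[of N] nnP[of "y N"] by linarith
  hence "summable (\<lambda>k. \<delta> * (y k \<bullet> y k))"
    using \<delta>(1) by (intro summableI_nonneg_bounded) auto
  hence "(\<lambda>k. \<delta> * (y k \<bullet> y k)) \<longlonglongrightarrow> 0" by (rule summable_LIMSEQ_zero)
  hence "(\<lambda>k. sqrt (1 / \<delta> * (\<delta> * (y k \<bullet> y k)))) \<longlonglongrightarrow> sqrt (1 / \<delta> * 0)"
    by (intro tendsto_intros)
  hence "(\<lambda>k. norm (y k)) \<longlonglongrightarrow> 0"
    using \<delta>(1) by (simp add: norm_eq_sqrt_inner)
  thus ?thesis unfolding y_def by (rule tendsto_norm_zero_cancel)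
qed

text \<open>
  With \<open>y = (z - A)\<^sup>-\<^sup>1 e j\<close> and \<open>\<bar>z\<bar> = 1\<close>, inserting \<open>A y = z y - e j\<close> into the Lyapunov inequality
  bounds \<open>\<bar>C y\<bar>\<^sup>2\<close> by \<open>2 Re (e j \<bullet> P (z y)) - P j j\<close>, and \<open>z y = \<Sum>k. z\<^sup>-\<^sup>k A\<^sup>k (e j)\<close> has mean \<open>e j\<close>
  over the unit circle. The truncated expansion makes the mean computable without integrability of
  the remainder.
\<close>
lemma h2_norm_power2_le_trace: "(h2_norm (transfer_matrix C A))\<^sup>2 \<le> trace P"
proof -
  obtain \<delta> where \<delta>: "\<delta> > 0"
    "\<And>x. \<delta> * (x \<bullet> x) + (A *v x) \<bullet> (P *v (A *v x)) + (C *v x) \<bullet> (C *v x) \<le> x \<bullet> (P *v x)"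
    using lyapunov_bound by blast
  define F where "F = (\<lambda>t. matrix_inv (mat (cis t) - complex_mat A))"
  define y where "y = (\<lambda>t j. F t *v axis j 1)"
  define qr qi where "qr = (\<lambda>t j. re_vec (cis t *s y t j))" and "qi = (\<lambda>t j. im_vec (cis t *s y t j))"
  \<comment> \<open>The resolvent exists on the unit circle because stability excludes eigenvalues
    of modulus 1.\<close>
  have y_eq: "cis t *s y t j - complex_mat A *v y t j = axis j 1" for t j
  proof -
    let ?M = "mat (cis t) - complex_mat A"
    have "?M *v v = 0 \<Longrightarrow> v = 0" for v
      using lyapunov_imp_schur_stable unfolding schur_stable_def
      by (auto simp: matrix_vector_mult_diff_rdistrib mat_vector_mult)
         (metis norm_cis less_irrefl)
    hence "invertible ?M"
      unfolding invertible_left_inverse matrix_left_invertible_ker by blast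
    hence "?M ** matrix_inv ?M = mat 1"
      by (rule invertible_matrix_inv)
    hence "?M *v y t j = axis j 1"
      by (simp add: y_def F_def matrix_vector_mul_assoc)
    thus ?thesis by (simp add: matrix_vector_mult_diff_rdistrib mat_vector_mult)
  qed
  have q_def: "qr t j = cos t *\<^sub>R re_vec (y t j) - sin t *\<^sub>R im_vec (y t j)"
    "qi t j = cos t *\<^sub>R im_vec (y t j) + sin t *\<^sub>R re_vec (y t j)" for t j
    by (simp_all add: qr_def qi_def)
  have Ay: "A *v re_vec (y t j) = qr t j - axis j 1" "A *v im_vec (y t j) = qi t j" for t j
    using arg_cong[OF y_eq[of t j], of re_vec] arg_cong[OF y_eq[of t j], of im_vec]
    by (simp_all add: qr_def qi_def algebra_simps)
  have pyth: "cos t * cos t + sin t * sin t = 1" for t :: real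
    using sin_cos_squared_add2[of t] by (simp add: power2_eq_square)
  have y_q: "re_vec (y t j) = cos t *\<^sub>R qr t j + sin t *\<^sub>R qi t j"
    "im_vec (y t j) = cos t *\<^sub>R qi t j - sin t *\<^sub>R qr t j" for t j
  proof -
    have "cos t *\<^sub>R qr t j + sin t *\<^sub>R qi t j = (cos t * cos t + sin t * sin t) *\<^sub>R re_vec (y t j)"
      "cos t *\<^sub>R qi t j - sin t *\<^sub>R qr t j = (cos t * cos t + sin t * sin t) *\<^sub>R im_vec (y t j)"
      by (simp_all only: q_def) (simp_all add: algebra_simps, simp_all add: pyth flip: scaleR_left_distrib)
    thus "re_vec (y t j) = cos t *\<^sub>R qr t j + sin t *\<^sub>R qi t j"
      "im_vec (y t j) = cos t *\<^sub>R qi t j - sin t *\<^sub>R qr t j"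
      by (simp_all add: pyth)
  qed
  define G where "G = (\<lambda>t j. \<Sum>i\<in>UNIV. (norm (transfer_matrix C A (cis t) $ i $ j))\<^sup>2)"
  have G: "G t j = (C *v re_vec (y t j)) \<bullet> (C *v re_vec (y t j)) +
      (C *v im_vec (y t j)) \<bullet> (C *v im_vec (y t j))" for t j
  proof -
    have "transfer_matrix C A (cis t) $ i $ j = (complex_mat C *v y t j) $ i" for i
    proof -
      have "y t j $ k = F t $ k $ j" for k
        by (simp add: y_def matrix_vector_mult_def axis_def if_distrib cong: if_cong)
      thus ?thesis
        by (simp add: transfer_matrix_def F_def matrix_matrix_mult_def
            matrix_vector_mult_def[of "complex_mat C"])
    qed
    thus ?thesis using sum_norm_power2_complex_vec[of "complex_mat C *v y t j"] by (simp add: G_def)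
  qed
  \<comment> \<open>The \<delta> term is kept to bound \<open>qr\<close> and \<open>qi\<close>
    uniformly in \<open>t\<close>: the left-hand side grows quadratically in them, the right-hand
    side only linearly.\<close>
  have main: "\<delta> * (qr t j \<bullet> qr t j + qi t j \<bullet> qi t j) + G t j \<le>
      2 * (axis j 1 \<bullet> (P *v qr t j)) - P $ j $ j" for t j
  proof -
    let ?a = "re_vec (y t j)" and ?b = "im_vec (y t j)"
    have I: "symmetric_mat (mat 1 :: real ^ 'n ^ 'n)" by (simp add: symmetric_mat_def)
    have "\<delta> * (?a \<bullet> ?a + ?b \<bullet> ?b) + G t j + (A *v ?a) \<bullet> (P *v (A *v ?a)) +
        (A *v ?b) \<bullet> (P *v (A *v ?b)) \<le> ?a \<bullet> (P *v ?a) + ?b \<bullet> (P *v ?b)"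
      using \<delta>(2)[of ?a] \<delta>(2)[of ?b] by (simp add: G algebra_simps)
    moreover have "qr t j \<bullet> (P *v qr t j) + qi t j \<bullet> (P *v qi t j) =
        ?a \<bullet> (P *v ?a) + ?b \<bullet> (P *v ?b)"
      unfolding q_def quad_form_rotate[OF symP] by simp
    moreover have "qr t j \<bullet> qr t j + qi t j \<bullet> qi t j = ?a \<bullet> ?a + ?b \<bullet> ?b"
      using quad_form_rotate[OF I, of "cos t" ?a "sin t" ?b] by (simp add: q_def)
    moreover have "axis j 1 \<bullet> (P *v axis j 1) = P $ j $ j"
      by (rule quad_form_axis)
    ultimately show ?thesis
      using symmetric_mat_inner[OF symP, of "qr t j" "axis j 1"]
      by (simp only: Ay quad_form_diff[OF symP])
  qed
  define e where "e = (\<lambda>j. P *v axis j 1)"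
  have e: "axis j 1 \<bullet> (P *v x) = e j \<bullet> x" for j x
    unfolding e_def by (metis symmetric_mat_inner[OF symP] inner_commute)
  have G_nn: "0 \<le> G t j" for t j by (simp add: G_def sum_nonneg)
  define r where "r = (\<lambda>j. 2 * norm (e j) / \<delta> + 1)"
  have q_bound: "norm (qr t j) \<le> r j" "norm (qi t j) \<le> r j" for t j
  proof -
    define s where "s = sqrt (qr t j \<bullet> qr t j + qi t j \<bullet> qi t j)"
    have s2: "s * s = qr t j \<bullet> qr t j + qi t j \<bullet> qi t j" by (simp add: s_def)
    have le: "norm (qr t j) \<le> s" "norm (qi t j) \<le> s"
      by (simp_all add: s_def norm_eq_sqrt_inner)
    have "P $ j $ j \<ge> 0"
      using nnP[of "axis j 1"] by (simp only: quad_form_axis)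
    hence "\<delta> * (s * s) \<le> 2 * (e j \<bullet> qr t j)"
      using main[of t j] G_nn[of t j] by (simp add: s2 e)
    also have "\<dots> \<le> 2 * (norm (e j) * norm (qr t j))"
      using norm_cauchy_schwarz[of "e j" "qr t j"] by simp
    also have "\<dots> \<le> 2 * (norm (e j) * s)"
      using le(1) by (intro mult_left_mono) auto
    finally have "(\<delta> * s) * s \<le> (2 * norm (e j)) * s" by (simp add: algebra_simps)
    hence "s \<le> 0 \<or> \<delta> * s \<le> 2 * norm (e j)"
      by (metis mult_le_cancel_right not_less)
    hence "s \<le> r j"
    proof
      assume "s \<le> 0"
      thus ?thesis using \<delta>(1) by (simp add: r_def add_nonneg_pos order_trans[of s 0])
    next
      assume "\<delta> * s \<le> 2 * norm (e j)"
      hence "s \<le> 2 * norm (e j) / \<delta>" using \<delta>(1) by (simp add: field_simps)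
      thus ?thesis by (simp add: r_def)
    qed
    thus "norm (qr t j) \<le> r j" "norm (qi t j) \<le> r j" using le by auto
  qed
  define Ap where "Ap = (\<lambda>k. ((*v) A) ^^ k)"
  have Ap_linear: "linear (Ap k)" for k
  proof (induction k)
    case (Suc k)
    then show ?case
      using linear_compose[OF Suc matrix_vector_mul_linear[of A]] by (simp add: Ap_def o_def)
  qed (simp add: Ap_def id_def linear_ident)
  have Ap_Suc: "Ap (Suc k) x = Ap k (A *v x)" for k x
    by (simp add: Ap_def funpow_swap1)
  \<comment> \<open>This is the real part of \<open>q = (\<Sum>k<N. z\<^sup>-\<^sup>k A\<^sup>k (e
    j)) + z\<^sup>-\<^sup>N A\<^sup>N q\<close> with \<open>q = z y\<close>, obtained by iterating
    \<open>q = e j + z\<^sup>-\<^sup>1 A q\<close>.\<close>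
  have expand: "qr t j = (\<Sum>k<N. cos (real k * t) *\<^sub>R Ap k (axis j 1)) +
      (cos (real N * t) *\<^sub>R Ap N (qr t j) + sin (real N * t) *\<^sub>R Ap N (qi t j))" for N t j
  proof (induction N)
    case 0
    then show ?case by (simp add: Ap_def)
  next
    case (Suc N)
    interpret linear "Ap N" by (rule Ap_linear)
    have qr': "qr t j = axis j 1 + cos t *\<^sub>R (A *v qr t j) + sin t *\<^sub>R (A *v qi t j)"
      using Ay(1)[of t j] unfolding y_q
      by (simp add: matrix_vector_right_distrib matrix_vector_mult_scaleR algebra_simps)
    have qi': "qi t j = cos t *\<^sub>R (A *v qi t j) - sin t *\<^sub>R (A *v qr t j)"
      using Ay(2)[of t j] unfolding y_q
      by (simp add: matrix_vector_mult_diff_distrib matrix_vector_mult_scaleR)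
    have "Ap N (qr t j) = Ap N (axis j 1) + cos t *\<^sub>R Ap (Suc N) (qr t j) + sin t *\<^sub>R Ap (Suc N) (qi t j)"
      by (subst qr') (simp add: add scale Ap_Suc)
    moreover have "Ap N (qi t j) = cos t *\<^sub>R Ap (Suc N) (qi t j) - sin t *\<^sub>R Ap (Suc N) (qr t j)"
      by (subst qi') (simp add: diff scale Ap_Suc)
    moreover have "cos (real (Suc N) * t) = cos (real N * t) * cos t - sin (real N * t) * sin t"
      "sin (real (Suc N) * t) = sin (real N * t) * cos t + cos (real N * t) * sin t"
      by (simp_all add: distrib_right cos_add sin_add add.commute)
    ultimately have "cos (real N * t) *\<^sub>R Ap N (qr t j) + sin (real N * t) *\<^sub>R Ap N (qi t j) =
        cos (real N * t) *\<^sub>R Ap N (axis j 1) +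
        (cos (real (Suc N) * t) *\<^sub>R Ap (Suc N) (qr t j) + sin (real (Suc N) * t) *\<^sub>R Ap (Suc N) (qi t j))"
      by (simp only:) (simp add: algebra_simps)
    then show ?case using Suc by (simp add: add.assoc)
  qed
  define \<epsilon> where "\<epsilon> = (\<lambda>N j. 2 * (norm (e j) * (r j * (\<Sum>i\<in>UNIV. norm (Ap N (axis i 1))))))"
  have Ap_bound: "norm (Ap N x) \<le> norm x * (\<Sum>i\<in>UNIV. norm (Ap N (axis i 1)))" for N x
  proof -
    interpret linear "Ap N" by (rule Ap_linear)
    have "x = (\<Sum>i\<in>UNIV. x $ i *\<^sub>R axis i 1)"
      by (simp add: vec_eq_iff axis_def if_distrib cong: if_cong)
    hence "Ap N x = (\<Sum>i\<in>UNIV. x $ i *\<^sub>R Ap N (axis i 1))" by (metis (no_types, lifting) sum scale sum.cong)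
    also have "norm \<dots> \<le> (\<Sum>i\<in>UNIV. norm x * norm (Ap N (axis i 1)))"
      by (rule sum_norm_le) (simp add: mult_right_mono component_le_norm_cart[simplified])
    finally show ?thesis by (simp add: sum_distrib_left)
  qed
  have rem: "e j \<bullet> (cos (real N * t) *\<^sub>R Ap N (qr t j) + sin (real N * t) *\<^sub>R Ap N (qi t j)) \<le> \<epsilon> N j"
    for N t j
  proof -
    let ?S = "\<Sum>i\<in>UNIV. norm (Ap N (axis i 1))"
    have S: "?S \<ge> 0" by (simp add: sum_nonneg)
    have "norm (cos (real N * t) *\<^sub>R Ap N (qr t j)) \<le> 1 * (r j * ?S)"
      unfolding norm_scaleR
      by (intro mult_mono order_trans[OF Ap_bound mult_right_mono[OF q_bound(1) S]]) auto
    moreover have "norm (sin (real N * t) *\<^sub>R Ap N (qi t j)) \<le> 1 * (r j * ?S)"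
      unfolding norm_scaleR
      by (intro mult_mono order_trans[OF Ap_bound mult_right_mono[OF q_bound(2) S]]) auto
    ultimately have "norm (cos (real N * t) *\<^sub>R Ap N (qr t j) + sin (real N * t) *\<^sub>R Ap N (qi t j)) \<le>
        2 * (r j * ?S)" by (intro norm_triangle_le) simp
    hence "norm (e j) * norm (cos (real N * t) *\<^sub>R Ap N (qr t j) + sin (real N * t) *\<^sub>R Ap N (qi t j)) \<le>
        norm (e j) * (2 * (r j * ?S))" by (intro mult_left_mono) auto
    thus ?thesis
      unfolding \<epsilon>_def
      by (intro order_trans[OF norm_cauchy_schwarz]) (simp add: mult.left_commute)
  qed
  have \<epsilon>: "(\<lambda>N. \<Sum>j\<in>UNIV. \<epsilon> N j) \<longlonglongrightarrow> 0"
  proof -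
    have "(\<lambda>N. \<Sum>j\<in>UNIV. \<epsilon> N j) \<longlonglongrightarrow>
        (\<Sum>j\<in>UNIV. 2 * (norm (e j) * (r j * (\<Sum>i\<in>(UNIV :: 'n set). 0))))"
      unfolding \<epsilon>_def Ap_def
      by (intro tendsto_intros tendsto_norm_zero power_mult_tendsto_0)
    thus ?thesis by simp
  qed
  define J where "J = (\<lambda>t. \<Sum>i\<in>UNIV. \<Sum>j\<in>UNIV. (norm (transfer_matrix C A (cis t) $ i $ j))\<^sup>2)"
  have J: "J t = (\<Sum>j\<in>UNIV. G t j)" for t
    unfolding J_def G_def by (rule sum.swap)
  \<comment> \<open>Averaging the bound leaves only the term \<open>k = 0\<close>, which
    \<open>N > 0\<close> ensures is present. It contributes \<open>2 * P $ j $ j\<close>, and the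
    subtracted diagonal entry reduces this to \<open>P $ j $ j\<close>.\<close>
  have le_N: "integral {- pi..pi} J \<le> 2 * pi * (trace P + 2 * (\<Sum>j\<in>UNIV. \<epsilon> N j))"
    if int: "J integrable_on {- pi..pi}" and N: "N > 0" for N
  proof -
    have const: "((\<lambda>t. c) has_integral 2 * pi * c) {- pi..pi}" for c :: real
      using has_integral_const_real[of c "- pi" pi] by simp
    define B where "B = (\<lambda>t. \<Sum>j\<in>UNIV. 2 * (\<Sum>k<N. (e j \<bullet> Ap k (axis j 1)) * cos (real k * t))
        + (2 * \<epsilon> N j - P $ j $ j))"
    have "J t \<le> B t" for t
      unfolding J B_def
    proof (rule sum_mono)
      fix j
      have "e j \<bullet> qr t j \<le> (\<Sum>k<N. (e j \<bullet> Ap k (axis j 1)) * cos (real k * t)) + \<epsilon> N j"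
        using rem[of j N t]
        by (subst expand[of t j N]) (simp add: inner_add_right inner_sum_right mult.commute)
      moreover have "0 \<le> \<delta> * (qr t j \<bullet> qr t j + qi t j \<bullet> qi t j)" using \<delta>(1) by simp
      ultimately show "G t j \<le> 2 * (\<Sum>k<N. (e j \<bullet> Ap k (axis j 1)) * cos (real k * t))
        + (2 * \<epsilon> N j - P $ j $ j)"
        using main[of t j] by (simp add: e)
    qed
    moreover have "(B has_integral (\<Sum>j\<in>UNIV. 2 * (\<Sum>k<N. (e j \<bullet> Ap k (axis j 1)) *
        (if k = 0 then 2 * pi else 0)) + (2 * pi) * (2 * \<epsilon> N j - P $ j $ j))) {- pi..pi}"
      unfolding B_def
      by (intro has_integral_sum has_integral_add has_integral_mult_right integral_cos_period
          const finite finite_lessThan)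
    moreover have "(\<Sum>k<N. (e j \<bullet> Ap k (axis j 1)) * (if k = 0 then 2 * pi else 0)) = 2 * pi * P $ j $ j"
      for j
    proof -
      have "(\<Sum>k<N. (e j \<bullet> Ap k (axis j 1)) * (if k = 0 then 2 * pi else 0)) =
          e j \<bullet> Ap 0 (axis j 1) * (2 * pi)"
        using N by (simp add: if_distrib cong: if_cong)
      also have "e j \<bullet> Ap 0 (axis j 1) = P $ j $ j"
        by (simp add: Ap_def e_def matrix_vector_mult_basis column_def inner_axis)
      finally show ?thesis by simp
    qed
    moreover have "(\<Sum>j\<in>UNIV. 2 * (2 * pi * P $ j $ j) + (2 * pi) * (2 * \<epsilon> N j - P $ j $ j)) =
        2 * pi * (trace P + 2 * (\<Sum>j\<in>UNIV. \<epsilon> N j))"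
    proof -
      have "(\<Sum>j\<in>UNIV. 2 * (2 * pi * P $ j $ j) + (2 * pi) * (2 * \<epsilon> N j - P $ j $ j)) =
          (\<Sum>j\<in>UNIV. 2 * pi * (P $ j $ j + 2 * \<epsilon> N j))"
        by (intro sum.cong refl) (simp add: algebra_simps)
      thus ?thesis by (simp add: trace_def sum.distrib flip: sum_distrib_left)
    qed
    ultimately show ?thesis
      using has_integral_le[OF integrable_integral[OF int]] by simp
  qed
  have "trace P \<ge> 0"
    unfolding trace_def
  proof (rule sum_nonneg)
    show "0 \<le> P $ j $ j" for j
      using nnP[of "axis j 1"] by (simp only: quad_form_axis)
  qed
  have "integral {- pi..pi} J \<le> 2 * pi * trace P"
  proof (cases "J integrable_on {- pi..pi}")
    case True
    have "(\<lambda>N. 2 * pi * (trace P + 2 * (\<Sum>j\<in>UNIV. \<epsilon> N j))) \<longlonglongrightarrow> 2 * pi * (trace P + 2 * 0)"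
      by (intro tendsto_intros \<epsilon>)
    hence "(\<lambda>N. 2 * pi * (trace P + 2 * (\<Sum>j\<in>UNIV. \<epsilon> N j))) \<longlonglongrightarrow> 2 * pi * trace P"
      by simp
    thus ?thesis
      by (rule LIMSEQ_le_const) (use le_N[OF True] in \<open>auto intro!: exI[of _ "1::nat"]\<close>)
  next
    \<comment> \<open>Here the integral has its default value 0, so nonnegativity of the trace
      suffices.\<close>
    case False
    thus ?thesis using \<open>trace P \<ge> 0\<close> by (simp add: not_integrable_integral)
  qed
  moreover have "0 \<le> integral {- pi..pi} J"
    by (cases "J integrable_on {- pi..pi}")
       (auto simp: J G_nn sum_nonneg not_integrable_integral intro!: integral_nonneg)
  ultimately show ?thesis
    by (simp add: h2_norm_def J_def[symmetric] field_simps)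
qed

end

section \<open>Block matrices acting on stacked vectors\<close>

definition stack_vec :: "'a ^ 'b \<Rightarrow> 'a ^ 'c \<Rightarrow> 'a ^ ('b::finite + 'c::finite)" where
  "stack_vec a b = (\<chi> i. case i of Inl k \<Rightarrow> a $ k | Inr k \<Rightarrow> b $ k)"

lemma stack_vec_nth [simp]: "stack_vec a b $ Inl i = a $ i" "stack_vec a b $ Inr j = b $ j"
  by (simp_all add: stack_vec_def)

lemma sum_UNIV_sum_type:
  fixes f :: "'a::finite + 'b::finite \<Rightarrow> 'c::comm_monoid_add"
  shows "sum f UNIV = (\<Sum>i\<in>UNIV. f (Inl i)) + (\<Sum>j\<in>UNIV. f (Inr j))"
  using sum.Plus[of UNIV UNIV f] by (simp add: UNIV_Plus_UNIV)

lemma vec_eq_sum_iff: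
  fixes x y :: "'a ^ ('b::finite + 'c::finite)"
  shows "x = y \<longleftrightarrow> (\<forall>i. x $ Inl i = y $ Inl i) \<and> (\<forall>j. x $ Inr j = y $ Inr j)"
  unfolding vec_eq_iff split_sum_all ..

lemma stack_vec_cases:
  obtains a b where "x = stack_vec a b"
  by (rule that[of "\<chi> i. x $ Inl i" "\<chi> j. x $ Inr j"]) (simp add: vec_eq_sum_iff)

lemma stack_vec_eq_0_iff: "stack_vec a b = 0 \<longleftrightarrow> a = 0 \<and> b = 0"
  by (auto simp: vec_eq_iff split_sum_all)

lemma inner_stack_vec [simp]:
  fixes a c :: "real ^ 'n" and b d :: "real ^ 'm"
  shows "stack_vec a b \<bullet> stack_vec c d = a \<bullet> c + b \<bullet> d"
  by (simp add: inner_vec_def sum_UNIV_sum_type)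

lemma vstack_nth [simp]: "vstack A B $ Inl i = A $ i" "vstack A B $ Inr j = B $ j"
  by (simp_all add: vstack_def)

lemma hstack_nth [simp]: "hstack A B $ i $ Inl k = A $ i $ k" "hstack A B $ i $ Inr l = B $ i $ l"
  by (simp_all add: hstack_def)

lemma vstack_mult_vec [simp]:
  fixes A :: "real ^ 'c ^ 'r" and B :: "real ^ 'c ^ 's"
  shows "vstack A B *v x = stack_vec (A *v x) (B *v x)"
  by (simp add: vec_eq_sum_iff matrix_vector_mult_def)

lemma hstack_mult_vec [simp]:
  fixes A :: "real ^ 'c ^ 'r" and B :: "real ^ 'd ^ 'r"
  shows "hstack A B *v stack_vec a b = A *v a + B *v b"
  by (simp add: vec_eq_iff matrix_vector_mult_def sum_UNIV_sum_type)

lemma block2_mult_vec [simp]: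
  fixes A :: "real ^ 'c ^ 'r" and B :: "real ^ 'd ^ 'r" and C :: "real ^ 'c ^ 's"
  shows "block2 A B C D *v stack_vec a b = stack_vec (A *v a + B *v b) (C *v a + D *v b)"
  by (simp add: block2_def)

lemma transpose_vstack: "transpose (vstack A B) = hstack (transpose A) (transpose B)"
  by (simp add: vec_eq_iff split_sum_all transpose_def)

lemma transpose_hstack: "transpose (hstack A B) = vstack (transpose A) (transpose B)"
  by (simp add: vec_eq_iff split_sum_all transpose_def)

lemma hstack_vstack: "hstack (vstack A B) (vstack C D) = vstack (hstack A C) (hstack B D)"
  by (simp add: vec_eq_iff split_sum_all)

lemma transpose_block2:
  "transpose (block2 A B C D) = block2 (transpose A) (transpose C) (transpose B) (transpose D)"
  by (simp add: vec_eq_iff split_sum_all transpose_def block2_def)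

lemma hstack_mult_vstack:
  fixes A :: "real ^ 'c ^ 'r" and B :: "real ^ 'd ^ 'r"
  shows "hstack A B ** vstack C D = A ** C + B ** D"
  by (simp add: vec_eq_iff matrix_matrix_mult_def sum_UNIV_sum_type)

lemma block2_mult:
  fixes A :: "real ^ 'c ^ 'r" and B :: "real ^ 'd ^ 'r" and C :: "real ^ 'c ^ 's"
  shows "block2 A B C D ** block2 E F G H =
    block2 (A ** E + B ** G) (A ** F + B ** H) (C ** E + D ** G) (C ** F + D ** H)"
  by (simp add: vec_eq_iff split_sum_all matrix_matrix_mult_def sum_UNIV_sum_type block2_def)

lemma blk_block2 [simp]:
  "blk11 (block2 A B C D) = A" "blk12 (block2 A B C D) = B"
  "blk21 (block2 A B C D) = C" "blk22 (block2 A B C D) = D"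
  by (simp_all add: blk11_def blk12_def blk21_def blk22_def block2_def vec_eq_iff)

lemma block2_blk: "block2 (blk11 P) (blk12 P) (blk21 P) (blk22 P) = P"
  by (simp add: blk11_def blk12_def blk21_def blk22_def block2_def vec_eq_iff split_sum_all)

lemma symmetric_mat_block2:
  "symmetric_mat (block2 A B C D) \<longleftrightarrow> transpose A = A \<and> transpose B = C \<and> transpose D = D"
proof -
  have "block2 A' B' C' D' = block2 A B C D \<longleftrightarrow> A' = A \<and> B' = B \<and> C' = C \<and> D' = D"
    for A' B' C' D' by (metis blk_block2)
  moreover have "transpose C = B \<longleftrightarrow> transpose B = C" by (metis transpose_transpose)
  ultimately show ?thesis unfolding symmetric_mat_def transpose_block2 by auto
qed

lemma transpose_0 [simp]: "transpose 0 = 0"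
  by (simp add: transpose_def vec_eq_iff)

lemma congruence_inner:
  fixes V :: "real ^ 'k ^ 'n"
  shows "x \<bullet> ((transpose V ** P ** V) *v y) = (V *v x) \<bullet> (P *v (V *v y))"
  unfolding matrix_vector_mul_assoc[symmetric] inner_matrix_vector_transpose[of x "transpose V"]
  by (simp only: transpose_transpose)

lemma congruence_symmetric:
  fixes V :: "real ^ 'k ^ 'n"
  assumes "symmetric_mat P"
  shows "symmetric_mat (transpose V ** P ** V)"
  using assms by (simp add: symmetric_mat_def matrix_transpose_mul matrix_mul_assoc)

lemma transpose_mult_vec_eq_sum:
  fixes Z :: "real ^ 'k ^ 'n"
  shows "transpose Z *v v = (\<Sum>r\<in>UNIV. v $ r *\<^sub>R Z $ r)"
  by (simp add: vec_eq_iff matrix_vector_mult_def transpose_def mult.commute)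

lemma uminus_matrix_vector_mult: "(- A) *v x = - (A *v x)" for A :: "real ^ 'c ^ 'r"
  by (simp add: vec_eq_iff matrix_vector_mult_def sum_negf)

lemma matrix_vector_mult_minus_distrib: "A *v (- x) = - (A *v x)" for A :: "real ^ 'c ^ 'r"
  by (simp add: vec_eq_iff matrix_vector_mult_def sum_negf)

lemma matrix_minus_mult:
  "(- A) ** B = - (A ** B)" "B ** (- C) = - (B ** C)"
  for A :: "real ^ 'c ^ 'r"
  by (simp_all add: vec_eq_iff matrix_matrix_mult_def sum_negf)

lemma matrix_diff_mult: "(A - B) ** C = A ** C - B ** C" for A :: "real ^ 'c ^ 'r"
  by (simp add: vec_eq_iff matrix_matrix_mult_def left_diff_distrib sum_subtractf)

lemma transpose_arith:
  "transpose (A + B) = transpose A + transpose B" "transpose (A - B) = transpose A - transpose B"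
  "transpose (- A) = - transpose A" "transpose (c *\<^sub>R A) = c *\<^sub>R transpose A"
  for A B :: "real ^ 'c ^ 'r"
  by (simp_all add: transpose_def vec_eq_iff)

section \<open>The set of data-compatible systems\<close>

text \<open>The stacking of \<open>vectorize\<close>, but as a vector instead of a one-column
  matrix, so that \<open>*v\<close> applies and the inner product is the Frobenius one.\<close>

definition flat :: "'a ^ 'c ^ 'r \<Rightarrow> 'a ^ ('c::finite \<times> 'r::finite)" where
  "flat Z = (\<chi> k. Z $ snd k $ fst k)"

lemma flat_cases:
  obtains Z where "x = flat Z"
  by (rule that[of "\<chi> r c. x $ (c, r)"]) (simp add: flat_def vec_eq_iff)

lemma flat_arith:
  "flat A + flat B = flat (A + B)" "flat A - flat B = flat (A - B)" "- flat A = flat (- A)"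
  for A B :: "real ^ 'c ^ 'r"
  by (simp_all add: flat_def vec_eq_iff)

lemma flat_eq_iff: "flat A = flat B \<longleftrightarrow> A = B"
  by (simp add: flat_def vec_eq_iff) blast

lemma inner_flat:
  fixes A B :: "real ^ 'c ^ 'r"
  shows "flat A \<bullet> flat B = (\<Sum>r\<in>UNIV. A $ r \<bullet> B $ r)"
proof -
  have "flat A \<bullet> flat B = (\<Sum>c\<in>UNIV. \<Sum>r\<in>UNIV. A $ r $ c * B $ r $ c)"
    by (simp add: inner_vec_def flat_def sum.cartesian_product case_prod_unfold)
  also have "\<dots> = (\<Sum>r\<in>UNIV. \<Sum>c\<in>UNIV. A $ r $ c * B $ r $ c)" by (rule sum.swap)
  finally show ?thesis by (simp add: inner_vec_def)
qed

text \<open>The factor \<open>mat 1\<close> lets \<open>B\<close> act on each row of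
  \<open>Z\<close> separately; this is what decouples \<open>N22\<close> into copies of
  \<open>Q22\<close>, one for each row.\<close>

lemma kron_mat1_mult_flat:
  fixes Z :: "real ^ 'c ^ 'r" and B :: "real ^ 'c ^ 'd"
  shows "kron B (mat 1) *v flat Z = flat (Z ** transpose B)"
proof -
  have "(kron B (mat 1) *v flat Z) $ (d, r) = (Z ** transpose B) $ r $ d" for d r
  proof -
    have "(kron B (mat 1) *v flat Z) $ (d, r) =
        (\<Sum>c\<in>UNIV. \<Sum>r'\<in>UNIV. B $ d $ c * mat 1 $ r $ r' * Z $ r' $ c)"
      by (simp add: matrix_vector_mult_def flat_def kron_def sum.cartesian_product case_prod_unfold)
    also have "\<dots> = (\<Sum>c\<in>UNIV. Z $ r $ c * B $ d $ c)"
      by (intro sum.cong refl)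
         (simp add: mat_def if_distrib[of "\<lambda>a. _ * a"] if_distrib[of "\<lambda>a. a * _"]
           mult.commute cong: if_cong)
    finally show ?thesis by (simp add: matrix_matrix_mult_def transpose_def)
  qed
  thus ?thesis by (simp add: flat_def vec_eq_iff)
qed

lemma matrix_mult_row: "(A ** B) $ r = transpose B *v A $ r" for A :: "real ^ 'k ^ 'r"
  by (simp add: vec_eq_iff matrix_matrix_mult_def matrix_vector_mult_def transpose_def mult.commute)

lemma quad_form_column:
  fixes V :: "real ^ 1 ^ 'k"
  shows "(transpose V ** P ** V) $ 1 $ 1 = column 1 V \<bullet> (P *v column 1 V)"
proof -
  have "(transpose V ** P ** V) $ 1 $ 1 = axis 1 1 \<bullet> ((transpose V ** P ** V) *v axis 1 1)"
    by (simp only: quad_form_axis)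
  thus ?thesis unfolding congruence_inner by (simp only: matrix_vector_mult_basis)
qed

lemma column_vstack_vectorize:
  "column 1 (vstack (mat 1) (vectorize W)) = stack_vec 1 (flat W)"
  for W :: "real ^ 'c ^ 'r"
  by (simp add: vec_eq_sum_iff column_def vectorize_def flat_def mat_def)

text \<open>\<open>E\<close> sends a candidate \<open>[A B]\<close> to its residual, the only noise
  matrix with which it explains the data.\<close>

lemma E_mat_mult_vec:
  fixes Z :: "real ^ ('n::finite + 'm::finite) ^ 'n"
  shows "E_mat u x *v stack_vec 1 (flat Z) =
    stack_vec 1 (flat (X_plus x - Z ** XU_minus u x :: real ^ 't::{finite,linorder} ^ 'n))"
proof -
  have "vectorize (X_plus x :: real ^ 't::{finite,linorder} ^ 'n) *v 1 = flat (X_plus x)"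
    by (simp add: vectorize_def flat_def vec_eq_iff matrix_vector_mult_def)
  thus ?thesis
    by (simp add: E_mat_def uminus_matrix_vector_mult kron_mat1_mult_flat flat_arith)
qed

lemma Sigma_D_iff:
  "(A, B) \<in> Sigma_D u x (W_F \<Phi>) \<longleftrightarrow>
    0 \<le> stack_vec 1 (flat (hstack A B)) \<bullet>
      (N_mat u x \<Phi> *v stack_vec 1 (flat (hstack A B)))"
proof -
  let ?W = "X_plus x - hstack A B ** XU_minus u x"
  have "hstack A B ** XU_minus u x = A ** X_minus x + B ** U_minus u"
    by (simp add: XU_minus_def hstack_mult_vstack)
  hence "X_plus x = A ** X_minus x + B ** U_minus u + W \<longleftrightarrow> W = ?W" for W
    by (auto simp: algebra_simps)
  hence "(A, B) \<in> Sigma_D u x (W_F \<Phi>) \<longleftrightarrow> ?W \<in> W_F \<Phi>"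
    unfolding Sigma_D_def mem_Collect_eq prod.case by metis
  thus ?thesis
    unfolding W_F_def mem_Collect_eq quad_form_column column_vstack_vectorize N_mat_def
      congruence_inner E_mat_mult_vec .
qed

text \<open>
  Completing the square turns the quadratic inequality of the data into a ball around \<open>Z0\<close>, in
  the weighted Frobenius norm for \<open>Sigma_D\<close> and in the weighted spectral norm for \<open>Q\<close>.
\<close>
lemma data_ball:
  fixes u :: "nat \<Rightarrow> real ^ 'm" and x :: "nat \<Rightarrow> real ^ 'n"
    and \<Phi> :: "real ^ (1 + 't::{finite,linorder} \<times> 'n) ^ (1 + 't \<times> 'n)"
    and \<phi> :: "real ^ 't::{finite,linorder} ^ 't::{finite,linorder}"
  assumes \<Phi>: "\<Phi> \<in> Pi_set" and \<phi>: "symmetric_mat \<phi>" and \<Phi>22: "blk22 \<Phi> = kron \<phi> (mat 1)"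
  defines "H \<equiv> Q22_mat u x \<phi>" and "\<rho> \<equiv> gen_schur (N_mat u x \<Phi>) $ 1 $ 1"
  obtains Z0 :: "real ^ ('n + 'm) ^ 'n"
  where "psd (- H)" "symmetric_mat (Q_mat u x \<Phi> \<phi>)"
    "\<And>A B. (A, B) \<in> Sigma_D u x (W_F \<Phi>) \<longleftrightarrow>
      0 \<le> \<rho> + (\<Sum>r\<in>UNIV. (hstack A B - Z0) $ r \<bullet> (H *v (hstack A B - Z0) $ r))"
    "\<And>v w. stack_vec v w \<bullet> (Q_mat u x \<Phi> \<phi> *v stack_vec v w) =
      \<rho> * (v \<bullet> v) + (w - transpose Z0 *v v) \<bullet> (H *v (w - transpose Z0 *v v))"
proof -
  have sym\<Phi>: "symmetric_mat \<Phi>" and nsd\<Phi>: "psd (- blk22 \<Phi>)"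
    and ker\<Phi>: "\<And>\<xi>. blk22 \<Phi> *v \<xi> = 0 \<Longrightarrow> blk12 \<Phi> *v \<xi> = 0"
    using \<Phi> by (auto simp: Pi_set_def ker_def)
  let ?XU = "XU_minus u x :: real ^ 't::{finite,linorder} ^ ('n + 'm)"
  let ?X = "vectorize (X_plus x :: real ^ 't::{finite,linorder} ^ 'n)"
  define N where "N = N_mat u x \<Phi>"
  define E22 where "E22 = - kron (transpose ?XU) (mat 1 :: real ^ 'n ^ 'n)"
  have symN: "symmetric_mat N" unfolding N_def N_mat_def by (rule congruence_symmetric[OF sym\<Phi>])
  have symH: "symmetric_mat H"
    unfolding H_def Q22_mat_def using congruence_symmetric[OF \<phi>, of "transpose ?XU"] by simp
  have N: "N = transpose (block2 (mat 1) 0 ?X E22) **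
      block2 (blk11 \<Phi>) (blk12 \<Phi>) (blk21 \<Phi>) (blk22 \<Phi>) ** block2 (mat 1) 0 ?X E22"
    by (simp add: N_def N_mat_def E_mat_def E22_def block2_blk)
  have N22: "blk22 N = transpose E22 ** blk22 \<Phi> ** E22"
    and N12: "blk12 N = (blk12 \<Phi> + transpose ?X ** blk22 \<Phi>) ** E22"
    unfolding N transpose_block2 block2_mult by simp_all
  \<comment> \<open>In Kronecker form \<open>N22\<close> is \<open>kron H (mat 1)\<close>; the two
    minus signs of \<open>E22\<close> cancel.\<close>
  have N22_flat: "blk22 N *v flat Z = flat (Z ** H)" for Z
  proof -
    have "transpose E22 = - kron ?XU (mat 1)"
      unfolding E22_def
      by (simp add: transpose_def kron_def vec_eq_iff mat_def)
    thus ?thesis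
      using \<phi> unfolding N22 \<Phi>22 E22_def H_def Q22_mat_def symmetric_mat_def
      by (simp add: uminus_matrix_vector_mult kron_mat1_mult_flat flat_arith matrix_mul_assoc
          matrix_minus_mult matrix_vector_mult_minus_distrib flip: matrix_vector_mul_assoc)
  qed
  have nsdN: "0 \<le> \<xi> \<bullet> (- blk22 N *v \<xi>)" for \<xi>
    unfolding N22 uminus_matrix_vector_mult inner_minus_right congruence_inner
    using nsd\<Phi> by (simp add: psd_def uminus_matrix_vector_mult)
  have nsdH: "psd (- H)"
  proof -
    have "0 \<le> w \<bullet> (- H *v w)" for w
    proof -
      \<comment> \<open>With every row equal to \<open>w\<close>, the form of \<open>N22\<close> is
        a positive multiple of that of \<open>H\<close>.\<close>
      let ?Z = "\<chi> (r :: 'n). w"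
      have "(?Z ** H) $ r = H *v w" for r
        using symH by (simp add: matrix_mult_row symmetric_mat_def)
      hence "flat ?Z \<bullet> (- blk22 N *v flat ?Z) = real CARD('n) * (w \<bullet> (- H *v w))"
        unfolding uminus_matrix_vector_mult N22_flat inner_minus_right inner_flat by simp
      thus ?thesis using nsdN[of "flat ?Z"] by (simp add: zero_le_mult_iff)
    qed
    thus ?thesis using symH by (auto simp: psd_def symmetric_mat_def transpose_def vec_eq_iff)
  qed
  \<comment> \<open>The kernel inclusion passes from \<Phi> to \<open>N\<close>: a vector killed by
    \<open>N22\<close> is mapped by \<open>E22\<close> to a zero of the semidefinite form of
    \<open>- blk22 \<Phi>\<close>, hence into its kernel.\<close>
  have kerN: "blk12 N *v \<xi> = 0" if "blk22 N *v \<xi> = 0" for \<xi>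
  proof -
    have "(E22 *v \<xi>) \<bullet> (- blk22 \<Phi> *v (E22 *v \<xi>)) = 0"
      using arg_cong[OF that, of "\<lambda>y. \<xi> \<bullet> y"]
      unfolding N22 congruence_inner uminus_matrix_vector_mult by simp
    hence "blk22 \<Phi> *v (E22 *v \<xi>) = 0"
      using psd_quad_form_eq_0[OF nsd\<Phi>] by (simp add: uminus_matrix_vector_mult)
    moreover from this have "blk12 \<Phi> *v (E22 *v \<xi>) = 0" by (rule ker\<Phi>)
    ultimately show ?thesis
      unfolding N12 by (simp add: matrix_vector_mult_add_rdistrib flip: matrix_vector_mul_assoc)
  qed
  have N_blocks: "transpose (blk11 N) = blk11 N" "transpose (blk12 N) = blk21 N"
    "transpose (blk22 N) = blk22 N"
    using symN symmetric_mat_block2[of "blk11 N" "blk12 N" "blk21 N" "blk22 N"]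
    unfolding block2_blk by auto
  hence N_blocks': "transpose (blk21 N) = blk12 N" by (metis transpose_transpose)
  define \<nu> where "\<nu> = column 1 (blk21 N)"
  have N12_pinv: "blk12 N ** pinv (blk22 N) ** blk22 N = blk12 N"
  proof -
    have "blk12 N *v (pinv (blk22 N) *v (blk22 N *v \<xi>) - \<xi>) = 0" for \<xi>
      using pinv_inner_inverse[of "blk22 N"]
      by (intro kerN) (simp add: matrix_vector_mult_diff_distrib matrix_vector_mul_assoc
          matrix_mul_assoc)
    thus ?thesis
      by (simp add: matrix_eq matrix_vector_mult_diff_distrib flip: matrix_vector_mul_assoc)
  qed
  \<comment> \<open>The centre has to solve \<open>blk22 N *v flat Z0 = - \<nu>\<close>. The kernel
    inclusion makes this solvable, and transposing \<open>N12_pinv\<close> yields the solution,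
    hence the transposed pseudoinverse.\<close>
  obtain Z0 where Z0: "flat Z0 = - (transpose (pinv (blk22 N)) *v \<nu>)"
    by (metis flat_cases)
  have "blk22 N *v flat Z0 = - \<nu>"
  proof -
    have "blk22 N ** transpose (pinv (blk22 N)) ** blk21 N = blk21 N"
      using arg_cong[OF N12_pinv, of transpose]
      by (simp add: matrix_transpose_mul N_blocks N_blocks' matrix_mul_assoc)
    hence "blk22 N *v (transpose (pinv (blk22 N)) *v \<nu>) = \<nu>"
      by (metis \<nu>_def matrix_vector_mul_assoc matrix_vector_mult_basis)
    thus ?thesis by (simp add: Z0 matrix_vector_mult_minus_distrib)
  qed
  have "flat (Q12_mat u x \<Phi>) = \<nu>"
    using vectorize_Q12[of u x \<Phi>] unfolding \<nu>_def N_def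
    by (metis (no_types, lifting) column_def flat_def vectorize_def vec_lambda_beta vec_lambda_unique)
  hence Q12: "Q12_mat u x \<Phi> = - (Z0 ** H)"
    using \<open>blk22 N *v flat Z0 = - \<nu>\<close> unfolding N22_flat
    by (metis flat_arith(3) flat_eq_iff minus_minus)
  \<comment> \<open>The Schur complement is what remains of the form of \<open>N\<close> at the
    centre, its maximum.\<close>
  have \<rho>: "\<rho> = blk11 N $ 1 $ 1 - flat Z0 \<bullet> flat (Z0 ** H)"
  proof -
    have "(blk12 N ** pinv (blk22 N) ** blk21 N) $ 1 $ 1 = \<nu> \<bullet> (pinv (blk22 N) *v \<nu>)"
      using quad_form_column[of "blk21 N" "pinv (blk22 N)"] by (simp add: N_blocks' \<nu>_def)
    also have "\<dots> = (blk22 N *v flat Z0) \<bullet> (pinv (blk22 N) *v (blk22 N *v flat Z0))"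
      by (simp add: \<open>blk22 N *v flat Z0 = - \<nu>\<close> matrix_vector_mult_minus_distrib)
    also have "\<dots> = flat Z0 \<bullet> ((blk22 N ** pinv (blk22 N) ** blk22 N) *v flat Z0)"
      unfolding matrix_vector_mul_assoc[symmetric]
        inner_matrix_vector_transpose[of "flat Z0" "blk22 N"] N_blocks ..
    finally show ?thesis
      by (simp add: \<rho>_def gen_schur_def N_def[symmetric] pinv_inner_inverse N22_flat)
  qed
  have Nform: "stack_vec 1 (flat Z) \<bullet> (N *v stack_vec 1 (flat Z)) =
      \<rho> + (\<Sum>r\<in>UNIV. (Z - Z0) $ r \<bullet> (H *v (Z - Z0) $ r))" for Z
  proof -
    have 1: "blk21 N *v 1 = \<nu>"
      by (simp add: \<nu>_def column_def matrix_vector_mult_def vec_eq_iff)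
    have 2: "1 \<bullet> (blk12 N *v \<xi>) = \<nu> \<bullet> \<xi>" for \<xi>
      by (simp only: inner_matrix_vector_transpose N_blocks 1)
    have 3: "1 \<bullet> (blk11 N *v 1) = blk11 N $ 1 $ 1"
      by (simp add: matrix_vector_mult_def inner_vec_def)
    have "\<nu> = - flat (Z0 ** H)"
      using \<open>blk22 N *v flat Z0 = - \<nu>\<close> unfolding N22_flat by simp
    moreover have "flat Z \<bullet> flat (Z0 ** H) = flat Z0 \<bullet> flat (Z ** H)"
      unfolding N22_flat[symmetric] by (rule symmetric_mat_inner) (simp add: symmetric_mat_def N_blocks)
    ultimately have "stack_vec 1 (flat Z) \<bullet> (N *v stack_vec 1 (flat Z)) =
        \<rho> + flat (Z - Z0) \<bullet> flat ((Z - Z0) ** H)"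
      unfolding \<rho>
      by (subst block2_blk[of N, symmetric])
         (simp add: 1 2 3 N22_flat inner_commute[of _ \<nu>] inner_add_right inner_diff_left inner_diff_right
           inner_commute[of _ "flat Z"] matrix_diff_mult flip: flat_arith(2))
    moreover have "(M ** H) $ r = H *v M $ r" for M :: "real ^ ('n + 'm) ^ 'n" and r
      unfolding matrix_mult_row by (simp only: symH[unfolded symmetric_mat_def])
    ultimately show ?thesis by (simp only: inner_flat)
  qed
  define Q where "Q = Q_mat u x \<Phi> \<phi>"
  have Q21: "transpose (Z0 ** H) = H ** transpose Z0"
    using symH by (simp add: matrix_transpose_mul symmetric_mat_def)
  have Q: "Q = block2 (\<rho> *\<^sub>R mat 1 + Z0 ** H ** transpose Z0) (- (Z0 ** H)) (- (H ** transpose Z0)) H"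
  proof -
    have "- (Z0 ** H) ** pinv H ** - (H ** transpose Z0) = Z0 ** (H ** pinv H ** H) ** transpose Z0"
      by (simp add: matrix_mul_assoc matrix_minus_mult)
    moreover have "transpose (- (Z0 ** H)) = - (H ** transpose Z0)"
      by (simp only: transpose_arith Q21)
    ultimately show ?thesis
      unfolding Q_def Q_mat_def Let_def H_def[symmetric] Q12 \<rho>_def pinv_inner_inverse by simp
  qed
  have "symmetric_mat Q"
    unfolding Q symmetric_mat_block2 using symH
    by (simp add: symmetric_mat_def transpose_arith matrix_transpose_mul matrix_mul_assoc)
  moreover have "stack_vec v w \<bullet> (Q *v stack_vec v w) =
      \<rho> * (v \<bullet> v) + (w - transpose Z0 *v v) \<bullet> (H *v (w - transpose Z0 *v v))" for v w
  proof -
    define t where "t = transpose Z0 *v v"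
    have t: "v \<bullet> (Z0 *v y) = t \<bullet> y" for y
      unfolding t_def by (rule inner_matrix_vector_transpose)
    have "Q *v stack_vec v w = stack_vec (\<rho> *\<^sub>R v + Z0 *v (H *v t) - Z0 *v (H *v w)) (H *v w - H *v t)"
      by (simp add: Q uminus_matrix_vector_mult matrix_vector_mult_add_rdistrib t_def
          flip: matrix_vector_mul_assoc scaleR_matrix_vector_assoc)
    thus ?thesis
      using symmetric_mat_inner[OF symH, of t w]
      unfolding t_def[symmetric] quad_form_diff[OF symH]
      by (simp add: inner_add_right inner_diff_right t)
  qed
  moreover have "(A, B) \<in> Sigma_D u x (W_F \<Phi>) \<longleftrightarrow>
      0 \<le> \<rho> + (\<Sum>r\<in>UNIV. (hstack A B - Z0) $ r \<bullet> (H *v (hstack A B - Z0) $ r))" for A B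
    unfolding Sigma_D_iff Nform[unfolded N_def] ..
  ultimately show ?thesis
    using that[of Z0] nsdH unfolding Q_def by blast
qed

section \<open>From the data to linear matrix inequalities\<close>

text \<open>
  Only vectors \<open>Z\<^sup>T v\<close> matter on the left-hand side, and \<open>Z0 + v d\<^sup>T / \<bar>v\<bar>\<^sup>2\<close> maps \<open>v\<close> to any prescribed
  deviation \<open>d\<close>. On the common kernel \<open>{0} \<times> ker H\<close> of the two forms the strict S-lemma fails, so it
  is applied on the orthogonal complement.
\<close>
lemma ball_S_lemma:
  fixes Z0 :: "real ^ 'k ^ 'n" and G :: "real ^ ('n + 'k) ^ ('n + 'k)"
  assumes H: "psd (- H)" and R: "psd R" and Y: "symmetric_mat Y" and G: "symmetric_mat G"
    and Gform: "\<And>v w. stack_vec v w \<bullet> (G *v stack_vec v w) =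
      \<rho> * (v \<bullet> v) + (w - transpose Z0 *v v) \<bullet> (H *v (w - transpose Z0 *v v))"
    and \<rho>: "\<rho> \<ge> 0"
  shows "(\<forall>Z v. 0 \<le> \<rho> + (\<Sum>r\<in>UNIV. (Z - Z0) $ r \<bullet> (H *v (Z - Z0) $ r)) \<longrightarrow> v \<noteq> 0 \<longrightarrow>
            (transpose Z *v v) \<bullet> (R *v (transpose Z *v v)) < v \<bullet> (Y *v v)) \<longleftrightarrow>
    (\<exists>\<alpha>\<ge>0. \<exists>\<beta>>0. \<forall>v w. \<beta> * (v \<bullet> v) + \<alpha> * (stack_vec v w \<bullet> (G *v stack_vec v w)) \<le>
       v \<bullet> (Y *v v) - w \<bullet> (R *v w))"
    (is "?L \<longleftrightarrow> ?R")
proof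
  have symH: "symmetric_mat H"
    using H by (simp add: psd_def symmetric_mat_def transpose_def vec_eq_iff)
  have symR: "symmetric_mat R" and nnR: "\<And>w. 0 \<le> w \<bullet> (R *v w)" using R by (auto simp: psd_def)
  {
    assume ?L
    have less: "w \<bullet> (R *v w) < v \<bullet> (Y *v v)"
      if "v \<noteq> 0" and nn: "0 \<le> stack_vec v w \<bullet> (G *v stack_vec v w)" for v w
    proof -
      have vv: "v \<bullet> v > 0" using that by simp
      define d where "d = w - transpose Z0 *v v"
      define Z where "Z = Z0 + (\<chi> r. (v $ r / (v \<bullet> v)) *\<^sub>R d)"
      have Z: "(Z - Z0) $ r = (v $ r / (v \<bullet> v)) *\<^sub>R d" for r by (simp add: Z_def)
      have "(\<Sum>r\<in>UNIV. (Z - Z0) $ r \<bullet> (H *v (Z - Z0) $ r)) =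
          (\<Sum>r\<in>UNIV. v $ r * v $ r) * ((d \<bullet> (H *v d)) / (v \<bullet> v)\<^sup>2)"
        unfolding Z quad_form_scaleR sum_distrib_right
        by (simp add: power_divide power2_eq_square)
      also have "\<dots> = (d \<bullet> (H *v d)) / (v \<bullet> v)"
        using vv by (simp add: inner_vec_def[of v v] power2_eq_square)
      finally have "\<rho> + (\<Sum>r\<in>UNIV. (Z - Z0) $ r \<bullet> (H *v (Z - Z0) $ r)) =
          (\<rho> * (v \<bullet> v) + d \<bullet> (H *v d)) / (v \<bullet> v)"
        using vv by (simp add: add_divide_distrib)
      hence "0 \<le> \<rho> + (\<Sum>r\<in>UNIV. (Z - Z0) $ r \<bullet> (H *v (Z - Z0) $ r))"
        using nn vv unfolding Gform d_def[symmetric] by simp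
      moreover have "transpose Z *v v = w"
      proof -
        have "transpose Z *v v = transpose Z0 *v v + (\<Sum>r\<in>UNIV. v $ r *\<^sub>R (Z - Z0) $ r)"
          unfolding transpose_mult_vec_eq_sum
          by (simp add: scaleR_diff_right sum_subtractf)
        also have "(\<Sum>r\<in>UNIV. v $ r *\<^sub>R (Z - Z0) $ r) = ((\<Sum>r\<in>UNIV. v $ r * v $ r) / (v \<bullet> v)) *\<^sub>R d"
          unfolding Z by (simp add: sum_divide_distrib flip: scaleR_left.sum)
        also have "\<dots> = d" using vv by (simp add: inner_vec_def)
        finally show ?thesis by (simp add: d_def)
      qed
      ultimately show ?thesis using \<open>?L\<close>[rule_format, of Z v] \<open>v \<noteq> 0\<close> by simp
    qed
    \<comment> \<open>With \<open>v\<close> fixed, moving \<open>w\<close> along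
      \<open>ker H\<close> leaves the form of \<open>G\<close> unchanged, so the form of
      \<open>R\<close> at \<open>w + t k\<close> stays below a constant for all \<open>t\<close>. A
      quadratic in \<open>t\<close> with positive leading coefficient cannot do that.\<close>
    have R0: "R *v k = 0" if k: "H *v k = 0" for k
    proof (rule ccontr)
      assume "R *v k \<noteq> 0"
      hence Rk: "k \<bullet> (R *v k) > 0"
        using psd_quad_form_eq_0[OF R] nnR[of k] by (metis order_le_less)
      define v :: "real ^ 'n" where "v = 1"
      have "v \<noteq> 0" by (simp add: v_def)
      define w where "w = transpose Z0 *v v"
      have lt: "(w + t *\<^sub>R k) \<bullet> (R *v (w + t *\<^sub>R k)) < v \<bullet> (Y *v v)" for t
      proof (rule less[OF \<open>v \<noteq> 0\<close>])
        have "w + t *\<^sub>R k - transpose Z0 *v v = t *\<^sub>R k" by (simp add: w_def)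
        thus "0 \<le> stack_vec v (w + t *\<^sub>R k) \<bullet> (G *v stack_vec v (w + t *\<^sub>R k))"
          unfolding Gform using \<rho> k by (simp add: matrix_vector_mult_scaleR)
      qed
      define b where "b = w \<bullet> (R *v k)"
      define s where "s = k \<bullet> (R *v k)"
      \<comment> \<open>The size of \<open>t\<close> makes the quadratic term alone reach the bound,
        and its sign makes the mixed term nonnegative.\<close>
      define t where "t = (if b \<ge> 0 then 1 else - 1) * sqrt ((v \<bullet> (Y *v v)) / s)"
      have vY: "v \<bullet> (Y *v v) \<ge> 0" using lt[of 0] nnR[of w] by simp
      have "t\<^sup>2 * s = v \<bullet> (Y *v v)"
        using vY Rk by (simp add: t_def power_mult_distrib s_def)
      moreover have "t * b \<ge> 0"
        using vY Rk by (simp add: t_def s_def mult_nonneg_nonpos)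
      ultimately show False
        using lt[of t] nnR[of w] unfolding quad_form_add[OF symR] quad_form_scaleR
        by (simp add: matrix_vector_mult_scaleR b_def s_def)
    qed
    define F where "F = block2 Y 0 0 (- R)"
    have F: "stack_vec v w \<bullet> (F *v stack_vec v w) = v \<bullet> (Y *v v) - w \<bullet> (R *v w)" for v w
      by (simp add: F_def uminus_matrix_vector_mult)
    have symF: "symmetric_mat F"
      using Y symR unfolding F_def symmetric_mat_block2
      by (simp add: symmetric_mat_def transpose_arith)
    define S where "S = {x :: real ^ ('n + 'k). \<forall>k. H *v k = 0 \<longrightarrow> x \<bullet> stack_vec 0 k = 0}"
    have subS: "subspace S" by (simp add: S_def subspace_def inner_add_left)
    have "0 < x \<bullet> (F *v x)" if x: "x \<in> S" "x \<noteq> 0" "0 \<le> x \<bullet> (G *v x)" for x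
    proof -
      obtain v w where vw: "x = stack_vec v w" by (rule stack_vec_cases)
      have "v \<noteq> 0"
      proof
        assume v: "v = 0"
        hence "0 \<le> w \<bullet> (H *v w)" using x(3) by (simp add: vw Gform)
        moreover have "0 \<le> w \<bullet> (- H *v w)" using H by (simp add: psd_def)
        ultimately have "w \<bullet> (- H *v w) = 0" by (simp add: uminus_matrix_vector_mult)
        hence "H *v w = 0" using psd_quad_form_eq_0[OF H, of w] by (simp add: uminus_matrix_vector_mult)
        hence "w \<bullet> w = 0" using x(1) by (auto simp: S_def vw)
        thus False using x(2) v by (simp add: vw stack_vec_eq_0_iff)
      qed
      thus ?thesis using less[of v w] x(3) by (simp add: vw F)
    qed
    then obtain \<alpha> \<beta> where ab: "\<alpha> \<ge> 0" "\<beta> > 0"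
      "\<And>x. x \<in> S \<Longrightarrow> \<beta> * (x \<bullet> x) \<le> x \<bullet> (F *v x) - \<alpha> * (x \<bullet> (G *v x))"
      using strict_S_lemma[OF symF G subS] by blast
    have "\<beta> * (v \<bullet> v) + \<alpha> * (stack_vec v w \<bullet> (G *v stack_vec v w)) \<le> v \<bullet> (Y *v v) - w \<bullet> (R *v w)"
      for v w
    proof -
      \<comment> \<open>Neither form sees the component \<open>k\<close> of \<open>w\<close> in
        \<open>ker H\<close>, so the inequality on \<open>S\<close> extends to all
        \<open>(v, w)\<close>.\<close>
      have "subspace (ker H)"
        by (simp add: ker_def subspace_def matrix_vector_right_distrib matrix_vector_mult_scaleR)
      then obtain k w' where k: "k \<in> ker H" "\<And>l. l \<in> ker H \<Longrightarrow> orthogonal w' l" "w = k + w'"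
        using orthogonal_subspace_decomp_exists[of "ker H" w] by (metis span_eq_iff)
      have "stack_vec v w' \<in> S" using k(2) by (simp add: S_def ker_def orthogonal_def)
      note ab(3)[OF this, unfolded F]
      moreover have G_eq: "stack_vec v w \<bullet> (G *v stack_vec v w) = stack_vec v w' \<bullet> (G *v stack_vec v w')"
      proof -
        have eq: "w - transpose Z0 *v v = k + (w' - transpose Z0 *v v)" by (simp add: k(3))
        have "H *v k = 0" using k(1) by (simp add: ker_def)
        thus ?thesis
          using symmetric_mat_inner[OF symH, of k "w' - transpose Z0 *v v"]
          unfolding Gform eq quad_form_add[OF symH] by simp
      qed
      moreover have "w \<bullet> (R *v w) = w' \<bullet> (R *v w')"
        using R0[of k] k(1) symmetric_mat_inner[OF symR, of k w']
        by (simp add: k(3) quad_form_add[OF symR] ker_def)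
      \<comment> \<open>The part of the margin in \<open>w'\<close> is dropped: it has no
        counterpart along \<open>ker H\<close>.\<close>
      moreover have "\<beta> * (v \<bullet> v) \<le> \<beta> * (stack_vec v w' \<bullet> stack_vec v w')"
        using ab(2) by simp
      ultimately show ?thesis
        unfolding G_eq by linarith
    qed
    with ab(1,2) show ?R by blast
  next
    assume ?R
    then obtain \<alpha> \<beta> where ab: "\<alpha> \<ge> 0" "\<beta> > 0"
      "\<And>v w. \<beta> * (v \<bullet> v) + \<alpha> * (stack_vec v w \<bullet> (G *v stack_vec v w)) \<le>
         v \<bullet> (Y *v v) - w \<bullet> (R *v w)" by blast
    show ?L
    proof (intro allI impI)
      fix Z :: "real ^ 'k ^ 'n" and v :: "real ^ 'n"
      assume ball: "0 \<le> \<rho> + (\<Sum>r\<in>UNIV. (Z - Z0) $ r \<bullet> (H *v (Z - Z0) $ r))" and v: "v \<noteq> 0"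
      let ?w = "transpose Z *v v"
      have d: "?w - transpose Z0 *v v = (\<Sum>r\<in>UNIV. v $ r *\<^sub>R (Z - Z0) $ r)"
        unfolding transpose_mult_vec_eq_sum by (simp add: scaleR_diff_right sum_subtractf)
      \<comment> \<open>\<open>psd_form_sum_le\<close> for \<open>- H\<close> places the Frobenius
        ball inside the spectral one.\<close>
      have "0 \<le> (v \<bullet> v) * (\<rho> + (\<Sum>r\<in>UNIV. (Z - Z0) $ r \<bullet> (H *v (Z - Z0) $ r)))"
        using ball by simp
      also have "\<dots> \<le> stack_vec v ?w \<bullet> (G *v stack_vec v ?w)"
        using psd_form_sum_le[OF H, of v "\<lambda>r. (Z - Z0) $ r"]
        unfolding Gform d uminus_matrix_vector_mult inner_minus_right sum_negf distrib_left
        by simp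
      finally have "0 \<le> \<alpha> * (stack_vec v ?w \<bullet> (G *v stack_vec v ?w))" using ab(1) by simp
      moreover have "0 < \<beta> * (v \<bullet> v)" using ab(2) v by simp
      ultimately show "?w \<bullet> (R *v ?w) < v \<bullet> (Y *v v)" using ab(3)[of v ?w] by linarith
    qed
  }
qed

section \<open>Schur complements for the linear matrix inequalities\<close>

lemma pd_block2_mat1_iff:
  fixes Y :: "real ^ 'n ^ 'n" and C :: "real ^ 'n ^ 'p"
  assumes "symmetric_mat Y"
  shows "pd (block2 Y (transpose C) C (mat 1)) \<longleftrightarrow> pd (Y - transpose C ** C)"
proof -
  let ?M = "block2 Y (transpose C) C (mat 1)" and ?S = "Y - transpose C ** C"
  have form: "stack_vec b c \<bullet> (?M *v stack_vec b c) = b \<bullet> (?S *v b) + (c + C *v b) \<bullet> (c + C *v b)" for b c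
  proof -
    have "b \<bullet> (transpose C *v y) = (C *v b) \<bullet> y" for y
      by (simp only: inner_matrix_vector_transpose transpose_transpose)
    thus ?thesis
      unfolding block2_mult_vec inner_stack_vec matrix_vector_mult_diff_rdistrib
        matrix_vector_mul_assoc[symmetric]
      by (simp add: inner_add_left inner_add_right inner_diff_right inner_commute
          del: transpose_matrix_vector)
  qed
  have symM: "symmetric_mat ?M" using assms unfolding symmetric_mat_block2 by (simp add: symmetric_mat_def)
  have symS: "symmetric_mat ?S"
    using assms by (simp add: symmetric_mat_def transpose_arith matrix_transpose_mul)
  show ?thesis
  proof
    assume M: "pd ?M"
    have "0 < b \<bullet> (?S *v b)" if "b \<noteq> 0" for b
    proof -
      have "stack_vec b (- (C *v b)) \<noteq> 0" using that by (simp add: stack_vec_eq_0_iff)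
      hence "0 < stack_vec b (- (C *v b)) \<bullet> (?M *v stack_vec b (- (C *v b)))"
        using M unfolding pd_def by blast
      thus ?thesis unfolding form by simp
    qed
    thus "pd ?S" using symS by (simp add: pd_def)
  next
    assume S: "pd ?S"
    have "0 < x \<bullet> (?M *v x)" if "x \<noteq> 0" for x
    proof -
      obtain b c where x: "x = stack_vec b c" by (rule stack_vec_cases)
      show ?thesis
      proof (cases "b = 0")
        case True
        then show ?thesis using that by (simp only: x form) (simp add: stack_vec_eq_0_iff)
      next
        case False
        then show ?thesis using S unfolding x form pd_def by (intro add_pos_nonneg) auto
      qed
    qed
    thus "pd ?M" using symM by (simp add: pd_def)
  qed
qed

lemma psd_block2_inverse_iff:
  assumes Y: "pd Y" and Z: "symmetric_mat Z"
  shows "psd (block2 Z (mat 1) (mat 1) Y) \<longleftrightarrow> psd (Z - matrix_inv Y)"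
proof -
  let ?M = "block2 Z (mat 1) (mat 1) Y"
  have symY: "symmetric_mat Y" "symmetric_mat (matrix_inv Y)"
    using Y pd_matrix_inv(3)[OF Y] by (simp_all add: pd_def)
  have form: "stack_vec a b \<bullet> (?M *v stack_vec a b) =
      a \<bullet> ((Z - matrix_inv Y) *v a) + (b + matrix_inv Y *v a) \<bullet> (Y *v (b + matrix_inv Y *v a))" for a b
    using pd_complete_square[OF Y, of a b]
    by (simp add: matrix_vector_mult_diff_rdistrib inner_add_right inner_diff_right inner_commute)
  have symM: "symmetric_mat ?M" "symmetric_mat (Z - matrix_inv Y)"
    using symY Z unfolding symmetric_mat_block2
    by (simp_all add: symmetric_mat_def transpose_arith)
  show ?thesis
  proof
    assume M: "psd ?M"
    have "0 \<le> a \<bullet> ((Z - matrix_inv Y) *v a)" for a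
    proof -
      have "0 \<le> stack_vec a (- (matrix_inv Y *v a)) \<bullet> (?M *v stack_vec a (- (matrix_inv Y *v a)))"
        using M unfolding psd_def by blast
      thus ?thesis unfolding form by simp
    qed
    thus "psd (Z - matrix_inv Y)" using symM by (simp add: psd_def)
  next
    assume S: "psd (Z - matrix_inv Y)"
    have "0 \<le> x \<bullet> (?M *v x)" for x
    proof -
      obtain a b where x: "x = stack_vec a b" by (rule stack_vec_cases)
      show ?thesis
        using S pd_imp_psd[OF Y] unfolding x form psd_def by (intro add_nonneg_nonneg) auto
    qed
    thus "psd ?M" using symM by (simp add: psd_def)
  qed
qed

lemma trace_nonneg_psd:
  assumes "psd A"
  shows "0 \<le> trace A"
  unfolding trace_def
proof (rule sum_nonneg)
  show "0 \<le> A $ j $ j" for j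
    using assms quad_form_axis[of j A] unfolding psd_def by metis
qed

text \<open>The minimum over \<open>Z\<close> is attained at \<open>Z = Y\<^sup>-\<^sup>1\<close>.\<close>
lemma trace_inverse_less_iff:
  assumes Y: "pd Y"
  shows "(\<exists>Z. symmetric_mat Z \<and> psd (block2 Z (mat 1) (mat 1) Y) \<and> trace Z < c) \<longleftrightarrow>
    trace (matrix_inv Y) < c"
proof
  assume "\<exists>Z. symmetric_mat Z \<and> psd (block2 Z (mat 1) (mat 1) Y) \<and> trace Z < c"
  then obtain Z where "psd (Z - matrix_inv Y)" "trace Z < c"
    using psd_block2_inverse_iff[OF Y] by blast
  thus "trace (matrix_inv Y) < c"
    using trace_nonneg_psd[of "Z - matrix_inv Y"] by (simp add: trace_sub)
next
  assume "trace (matrix_inv Y) < c"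
  moreover have "symmetric_mat (matrix_inv Y)" using pd_matrix_inv(3)[OF Y] by (simp add: pd_def)
  moreover have "psd (matrix_inv Y - matrix_inv Y)" by (simp add: psd_def symmetric_mat_def)
  ultimately show "\<exists>Z. symmetric_mat Z \<and> psd (block2 Z (mat 1) (mat 1) Y) \<and> trace Z < c"
    using psd_block2_inverse_iff[OF Y] by blast
qed

lemma hstack_cases:
  obtains A B where "Z = hstack A B"
  by (rule that[of "\<chi> i k. Z $ i $ Inl k" "\<chi> i l. Z $ i $ Inr l"])
     (simp add: vec_eq_iff split_sum_all)

lemma all_hstack_iff: "(\<forall>Z. P Z) \<longleftrightarrow> (\<forall>A B. P (hstack A B))"
  by (metis hstack_cases)

lemma pd_add_gram:
  fixes C :: "real ^ 'n ^ 'p"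
  assumes "symmetric_mat Y" "pd (Y - transpose C ** C)"
  shows "pd Y"
proof -
  have "0 < v \<bullet> (Y *v v)" if "v \<noteq> 0" for v
  proof -
    have "v \<bullet> ((transpose C ** C) *v v) = (C *v v) \<bullet> (C *v v)"
      using congruence_inner[of v C "mat 1" v] by simp
    moreover have "0 < v \<bullet> ((Y - transpose C ** C) *v v)"
      using assms(2) that by (auto simp: pd_def)
    ultimately show ?thesis
      using inner_ge_zero[of "C *v v"]
      unfolding matrix_vector_mult_diff_rdistrib inner_diff_right by linarith
  qed
  thus ?thesis using assms(1) by (simp add: pd_def)
qed

text \<open>The form is minimized over the last two blocks, which \<open>Q\<close> does not touch.
  Eliminating \<open>c\<close> through the identity block replaces \<open>Y\<close> by
  \<open>S\<close>; completing the square in \<open>b\<close> then produces the term with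
  \<open>matrix_inv S\<close>.\<close>

lemma psd_block5_iff:
  fixes Y :: "real ^ 'n ^ 'n" and L :: "real ^ 'n ^ 'm" and C :: "real ^ 'n ^ 'p"
    and Q :: "real ^ ('n + ('n + 'm)) ^ ('n + ('n + 'm))"
  assumes symY: "symmetric_mat Y" and Q: "symmetric_mat Q"
    and S: "pd (Y - transpose C ** C)"
  shows "psd (col5
           (row5 (Y - \<beta> *\<^sub>R mat 1) 0 0             0 0)
           (row5 0                 0 0             Y 0)
           (row5 0                 0 0             L 0)
           (row5 0                 Y (transpose L) Y (transpose C))
           (row5 0                 0 0             C (mat 1))
          - \<alpha> *\<^sub>R block2 Q 0 0 0) \<longleftrightarrow>
    (\<forall>v w. \<beta> * (v \<bullet> v) + \<alpha> * (stack_vec v w \<bullet> (Q *v stack_vec v w)) \<le> v \<bullet> (Y *v v) -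
       w \<bullet> ((vstack Y L ** matrix_inv (Y - transpose C ** C) ** transpose (vstack Y L)) *v w))"
    (is "psd ?M \<longleftrightarrow> _")
proof -
  define S where "S = Y - transpose C ** C"
  define R where "R = vstack Y L ** matrix_inv S ** transpose (vstack Y L)"
  define r where "r = (\<lambda>w. transpose (vstack Y L) *v w)"
  have pdS: "pd S" using S by (simp add: S_def)
  have R: "w \<bullet> (R *v w) = r w \<bullet> (matrix_inv S *v r w)" for w
    using congruence_inner[of w "transpose (vstack Y L)" "matrix_inv S" w]
    by (simp only: R_def r_def transpose_transpose)
  have adj: "x \<bullet> (transpose C *v y) = (C *v x) \<bullet> y" for x y
    by (simp only: inner_matrix_vector_transpose transpose_transpose)
  have adjL: "x \<bullet> (transpose L *v y) = (L *v x) \<bullet> y" for x y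
    by (simp only: inner_matrix_vector_transpose transpose_transpose)
  have form: "x \<bullet> (?M *v x) = v \<bullet> (Y *v v) - w \<bullet> (R *v w) - \<beta> * (v \<bullet> v) -
      \<alpha> * (stack_vec v w \<bullet> (Q *v stack_vec v w)) +
      (b + matrix_inv S *v r w) \<bullet> (S *v (b + matrix_inv S *v r w)) + (c + C *v b) \<bullet> (c + C *v b)"
    if x: "x = stack_vec (stack_vec v w) (stack_vec b c)" for x v w b c
  proof -
    obtain w1 w2 where w: "w = stack_vec w1 w2" by (rule stack_vec_cases)
    have rw: "r w = Y *v w1 + transpose L *v w2"
      using symY unfolding r_def w transpose_vstack hstack_mult_vec by (simp add: symmetric_mat_def)
    have "x \<bullet> (?M *v x) = v \<bullet> (Y *v v) - \<beta> * (v \<bullet> v) -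
        \<alpha> * (stack_vec v w \<bullet> (Q *v stack_vec v w)) + 2 * (r w \<bullet> b) + b \<bullet> (Y *v b) +
        2 * ((C *v b) \<bullet> c) + c \<bullet> c"
      unfolding x w col5_def row5_def
      unfolding matrix_vector_mult_diff_rdistrib scaleR_matrix_vector_assoc[symmetric]
      unfolding inner_diff_right inner_scaleR_right block2_mult_vec vstack_mult_vec hstack_mult_vec
        inner_stack_vec rw[unfolded w]
      using symmetric_mat_inner[OF symY, of w1 b]
      by (simp add: inner_add_right inner_add_left adj adjL inner_commute inner_diff_right
          matrix_vector_mult_diff_rdistrib
          del: transpose_matrix_vector flip: scaleR_matrix_vector_assoc)
    moreover have "b \<bullet> (Y *v b) = b \<bullet> (S *v b) + (C *v b) \<bullet> (C *v b)"
      by (simp add: S_def matrix_vector_mult_diff_rdistrib inner_diff_right adj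
          del: transpose_matrix_vector flip: matrix_vector_mul_assoc)
    moreover have "(c + C *v b) \<bullet> (c + C *v b) = c \<bullet> c + 2 * ((C *v b) \<bullet> c) + (C *v b) \<bullet> (C *v b)"
      by (simp add: inner_add_left inner_add_right inner_commute)
    ultimately show ?thesis
      using pd_complete_square[OF pdS, of "r w" b] unfolding R by linarith
  qed
  have "symmetric_mat ?M"
  proof -
    have "transpose Y = Y" "transpose Q = Q" using symY Q by (simp_all add: symmetric_mat_def)
    thus ?thesis
      by (simp add: symmetric_mat_def col5_def row5_def block2_def transpose_vstack
          transpose_hstack transpose_arith hstack_vstack)
  qed
  show ?thesis
    unfolding S_def[symmetric] R_def[symmetric]
  proof (intro iffI allI)
    fix v :: "real ^ 'n" and w :: "real ^ ('n + 'm)"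
    assume M: "psd ?M"
    \<comment> \<open>These are the minimizers, at which both squares in \<open>form\<close>
      vanish.\<close>
    let ?b = "- (matrix_inv S *v r w)"
    let ?x = "stack_vec (stack_vec v w) (stack_vec ?b (- (C *v ?b)))"
    have "0 \<le> ?x \<bullet> (?M *v ?x)" using M unfolding psd_def by blast
    thus "\<beta> * (v \<bullet> v) + \<alpha> * (stack_vec v w \<bullet> (Q *v stack_vec v w)) \<le> v \<bullet> (Y *v v) - w \<bullet> (R *v w)"
      unfolding form[OF refl] by simp
  next
    assume le: "\<forall>v w. \<beta> * (v \<bullet> v) + \<alpha> * (stack_vec v w \<bullet> (Q *v stack_vec v w)) \<le>
      v \<bullet> (Y *v v) - w \<bullet> (R *v w)"
    have "0 \<le> x \<bullet> (?M *v x)" for x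
    proof -
      obtain vw bc where x: "x = stack_vec vw bc" by (rule stack_vec_cases)
      obtain v w where vw: "vw = stack_vec v w" by (rule stack_vec_cases)
      obtain b c where bc: "bc = stack_vec b c" by (rule stack_vec_cases)
      have "0 \<le> y \<bullet> (S *v y)" for y using pd_imp_psd[OF pdS] by (simp add: psd_def)
      thus ?thesis
        unfolding form[OF x[unfolded vw bc]] using le[rule_format, of v w]
        by (intro add_nonneg_nonneg) auto
    qed
    with \<open>symmetric_mat ?M\<close> show "psd ?M" by (simp add: psd_def)
  qed
qed

text \<open>The outer factor maps \<open>v\<close> to \<open>(v, Z\<^sup>T v)\<close> with
  \<open>Z = [A B]\<close>, and the blocks of \<open>M_H2\<close> do not mix the two.\<close>

lemma pd_M_H2_iff:
  fixes A :: "real ^ 'n ^ 'n" and B :: "real ^ 'm ^ 'n" and C :: "real ^ 'n ^ 'p"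
  assumes Y: "symmetric_mat Y" and S: "pd (Y - transpose (C_cl C D Y L) ** C_cl C D Y L)"
  shows "pd (transpose (vstack (mat 1) (vstack (transpose A) (transpose B))) ** M_H2 C D (Y, L) **
      vstack (mat 1) (vstack (transpose A) (transpose B))) \<longleftrightarrow>
    (\<forall>v. v \<noteq> 0 \<longrightarrow> (transpose (hstack A B) *v v) \<bullet>
      ((vstack Y L ** matrix_inv (Y - transpose (C_cl C D Y L) ** C_cl C D Y L) **
        transpose (vstack Y L)) *v (transpose (hstack A B) *v v)) < v \<bullet> (Y *v v))"
proof -
  define R where "R = vstack Y L ** matrix_inv (Y - transpose (C_cl C D Y L) ** C_cl C D Y L) **
        transpose (vstack Y L)"
  have M: "M_H2 C D (Y, L) = block2 Y 0 0 (- R)" by (simp add: M_H2_def R_def)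
  have "symmetric_mat R" using psd_congruence_matrix_inv[OF S, of "vstack Y L"] by (simp add: R_def psd_def)
  hence "symmetric_mat (M_H2 C D (Y, L))"
    using Y unfolding M symmetric_mat_block2 by (simp add: symmetric_mat_def transpose_arith)
  note sym = congruence_symmetric[OF this]
  have V: "vstack (mat 1) (vstack (transpose A) (transpose B)) *v v =
      stack_vec v (transpose (hstack A B) *v v)" for v
    by (simp add: transpose_hstack)
  have form: "stack_vec v w \<bullet> (M_H2 C D (Y, L) *v stack_vec v w) = v \<bullet> (Y *v v) - w \<bullet> (R *v w)" for v w
    by (simp add: M uminus_matrix_vector_mult)
  show ?thesis
    unfolding pd_def congruence_inner V form R_def[symmetric] using sym by auto
qed

text \<open>
  Dualization: with \<open>T = (A + B K) Y\<close>, both \<open>T S\<^sup>-\<^sup>1 T\<^sup>T < Y\<close> and \<open>T\<^sup>T Y\<^sup>-\<^sup>1 T < S\<close> say that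
  the block matrix with rows \<open>Y, T\<close> and \<open>T\<^sup>T, S\<close> is positive definite.
\<close>
lemma closed_loop_lyapunov:
  fixes A :: "real ^ 'n ^ 'n" and B :: "real ^ 'm ^ 'n" and C :: "real ^ 'n ^ 'p"
    and D :: "real ^ 'm ^ 'p" and L :: "real ^ 'n ^ 'm"
  assumes symY: "symmetric_mat Y"
  defines "S \<equiv> Y - transpose (C_cl C D Y L) ** C_cl C D Y L" and "K \<equiv> L ** matrix_inv Y"
  assumes S: "pd S" and x: "x \<noteq> 0"
    and less: "\<And>v. v \<noteq> 0 \<Longrightarrow> (transpose (hstack A B) *v v) \<bullet>
      ((vstack Y L ** matrix_inv S ** transpose (vstack Y L)) *v (transpose (hstack A B) *v v)) <
      v \<bullet> (Y *v v)"
  shows "((A + B ** K) *v x) \<bullet> (matrix_inv Y *v ((A + B ** K) *v x)) +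
    ((C + D ** K) *v x) \<bullet> ((C + D ** K) *v x) < x \<bullet> (matrix_inv Y *v x)"
proof -
  have Y: "pd Y" using pd_add_gram[OF symY] S by (simp add: S_def)
  define y where "y = matrix_inv Y *v x"
  have xy: "x = Y *v y" by (simp add: y_def matrix_inv_mult_vec[OF Y])
  have "y \<noteq> 0" using x xy by auto
  define T where "T = A ** Y + B ** L"
  define z where "z = T *v y"
  \<comment> \<open>The hypothesis concerns the transposed closed loop; it is tested at this
    \<open>v\<close>, so that \<open>v \<bullet> (Y *v v)\<close> is the value of the dual form at
    \<open>z\<close>.\<close>
  define v where "v = matrix_inv Y *v z"
  have Kx: "K *v x = L *v y" by (simp add: K_def y_def flip: matrix_vector_mul_assoc)
  have AK: "(A + B ** K) *v x = z"
    unfolding matrix_vector_mult_add_rdistrib matrix_vector_mul_assoc[symmetric] Kx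
    by (simp add: z_def T_def xy matrix_vector_mult_add_rdistrib flip: matrix_vector_mul_assoc)
  have CK: "(C + D ** K) *v x = C_cl C D Y L *v y"
    unfolding matrix_vector_mult_add_rdistrib matrix_vector_mul_assoc[symmetric] Kx
    by (simp add: C_cl_def xy matrix_vector_mult_add_rdistrib flip: matrix_vector_mul_assoc)
  have Sy: "y \<bullet> (S *v y) = y \<bullet> (Y *v y) - (C_cl C D Y L *v y) \<bullet> (C_cl C D Y L *v y)"
    using congruence_inner[of y "C_cl C D Y L" "mat 1" y]
    by (simp add: S_def matrix_vector_mult_diff_rdistrib inner_diff_right)
  have "z \<bullet> (matrix_inv Y *v z) < y \<bullet> (S *v y)"
  proof (cases "z = 0")
    case True
    then show ?thesis using S \<open>y \<noteq> 0\<close> by (simp add: pd_def)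
  next
    case False
    have zv: "z = Y *v v" by (simp add: v_def matrix_inv_mult_vec[OF Y])
    have "v \<noteq> 0" using False zv by auto
    define r where "r = transpose T *v v"
    have r: "transpose (vstack Y L) *v (transpose (hstack A B) *v v) = r"
      by (simp only: r_def T_def matrix_vector_mul_assoc hstack_mult_vstack flip: matrix_transpose_mul)
    have "r \<bullet> (matrix_inv S *v r) < v \<bullet> (Y *v v)"
      using less[OF \<open>v \<noteq> 0\<close>]
      unfolding congruence_inner[of _ "transpose (vstack Y L)", unfolded transpose_transpose] r .
    also have "v \<bullet> (Y *v v) = z \<bullet> (matrix_inv Y *v z)"
      unfolding zv[symmetric] by (simp add: v_def inner_commute)
    finally have 1: "r \<bullet> (matrix_inv S *v r) < z \<bullet> (matrix_inv Y *v z)" .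
    have 2: "z \<bullet> (matrix_inv Y *v z) = r \<bullet> y"
      unfolding v_def[symmetric] by (simp only: r_def z_def inner_commute[of _ v]
          inner_matrix_vector_transpose[of v T y])
    \<comment> \<open>The square yields \<open>2 r \<bullet> y \<le> y \<bullet> S y + r \<bullet>
      S\<^sup>-\<^sup>1 r\<close>. As \<open>r \<bullet> y\<close> equals the value at
      \<open>z\<close> and strictly exceeds the last term, one copy of it cancels.\<close>
    have "0 \<le> (- y + matrix_inv S *v r) \<bullet> (S *v (- y + matrix_inv S *v r))"
      using pd_imp_psd[OF S] by (simp add: psd_def)
    hence "2 * (r \<bullet> y) \<le> y \<bullet> (S *v y) + r \<bullet> (matrix_inv S *v r)"
      using pd_complete_square[OF S, of r "- y"] by (simp add: matrix_vector_mult_minus_distrib)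
    with 1 2 show ?thesis by linarith
  qed
  thus ?thesis
    using Sy unfolding AK CK y_def[symmetric] by (simp add: xy inner_commute)
qed

theorem theorem5:
  fixes u :: "nat \<Rightarrow> real ^ 'm" and x :: "nat \<Rightarrow> real ^ 'n"
    and \<Phi> :: "real ^ (1 + 't::{finite,linorder} \<times> 'n) ^ (1 + 't \<times> 'n)"
    and \<phi> :: "real ^ 't::{finite,linorder} ^ 't::{finite,linorder}"
    and A\<^sub>s :: "real ^ 'n ^ 'n" and B\<^sub>s :: "real ^ 'm ^ 'n"
    and C :: "real ^ 'n ^ 'p" and D :: "real ^ 'm ^ 'p"
    and \<gamma> :: real
  assumes "\<Phi> \<in> Pi_set"
    and "symmetric_mat \<phi>"
    and "blk22 \<Phi> = kron \<phi> (mat 1)"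
    and "(A\<^sub>s, B\<^sub>s) \<in> Sigma_D u x (W_F \<Phi>)"
    and "\<gamma> > 0"
  shows "(informative (Theta_H2 \<gamma> C D) (M_H2 C D) u x (W_F \<Phi>) \<longleftrightarrow>
           (\<exists>Y Z L \<alpha> \<beta>. symmetric_mat Y \<and> symmetric_mat Z \<and> \<alpha> \<ge> 0 \<and> \<beta> > 0 \<and>
              H2_LMIs u x \<Phi> \<phi> \<gamma> C D Y Z L \<alpha> \<beta>)) \<and>
         (\<forall>Y Z L \<alpha> \<beta>. symmetric_mat Y \<and> symmetric_mat Z \<and> \<alpha> \<ge> 0 \<and> \<beta> > 0 \<and>
              H2_LMIs u x \<Phi> \<phi> \<gamma> C D Y Z L \<alpha> \<beta> \<longrightarrow>
            (let K = L ** matrix_inv Y in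
             \<forall>(A, B) \<in> Sigma_D u x (W_F \<Phi>).
               schur_stable (A + B ** K) \<and>
               h2_norm (transfer_matrix (C + D ** K) (A + B ** K)) < \<gamma>))"
proof -
  define H where "H = Q22_mat u x \<phi>"
  define \<rho> where "\<rho> = gen_schur (N_mat u x \<Phi>) $ 1 $ 1"
  define Q where "Q = Q_mat u x \<Phi> \<phi>"
  define \<Sigma> where "\<Sigma> = Sigma_D u x (W_F \<Phi>)"
  obtain Z0 where H: "psd (- H)" and symQ: "symmetric_mat Q"
    and \<Sigma>: "\<And>A B. (A, B) \<in> \<Sigma> \<longleftrightarrow>
      0 \<le> \<rho> + (\<Sum>r\<in>UNIV. (hstack A B - Z0) $ r \<bullet> (H *v (hstack A B - Z0) $ r))"
    and Q: "\<And>v w. stack_vec v w \<bullet> (Q *v stack_vec v w) =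
      \<rho> * (v \<bullet> v) + (w - transpose Z0 *v v) \<bullet> (H *v (w - transpose Z0 *v v))"
    using data_ball[OF assms(1-3), of u x] unfolding H_def \<rho>_def Q_def \<Sigma>_def by blast
  \<comment> \<open>The true system lies in the ball, and the form of \<open>H\<close> can only
    lower the value below the radius.\<close>
  have "\<rho> \<ge> 0"
  proof -
    have "w \<bullet> (H *v w) \<le> 0" for w using H by (simp add: psd_def uminus_matrix_vector_mult)
    hence "(\<Sum>r\<in>UNIV. (hstack A\<^sub>s B\<^sub>s - Z0) $ r \<bullet> (H *v (hstack A\<^sub>s B\<^sub>s - Z0) $ r)) \<le> 0"
      by (intro sum_nonpos)
    thus ?thesis using assms(4) unfolding \<Sigma>_def[symmetric] \<Sigma> by linarith
  qed
  define S where "S = (\<lambda>Y L. Y - transpose (C_cl C D Y L) ** C_cl C D Y L)"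
  define R where "R = (\<lambda>Y L. vstack Y L ** matrix_inv (S Y L) ** transpose (vstack Y L))"
  define robust where "robust = (\<lambda>Y L. \<forall>A B. (A, B) \<in> \<Sigma> \<longrightarrow> (\<forall>v. v \<noteq> 0 \<longrightarrow>
    (transpose (hstack A B) *v v) \<bullet> (R Y L *v (transpose (hstack A B) *v v)) < v \<bullet> (Y *v v)))"
  define lmi where "lmi = (\<lambda>Y L \<alpha> \<beta>. psd (col5
           (row5 (Y - \<beta> *\<^sub>R mat 1) 0 0             0            0)
           (row5 0                 0 0             Y            0)
           (row5 0                 0 0             L            0)
           (row5 0                 Y (transpose L) Y            (transpose (C_cl C D Y L)))
           (row5 0                 0 0             (C_cl C D Y L) (mat 1))
          - \<alpha> *\<^sub>R block2 Q 0 0 0))"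
  have robust_iff: "robust Y L \<longleftrightarrow> (\<exists>\<alpha>\<ge>0. \<exists>\<beta>>0. lmi Y L \<alpha> \<beta>)"
    if symY: "symmetric_mat Y" and S: "pd (S Y L)" for Y L
  proof -
    have psdR: "psd (R Y L)" using psd_congruence_matrix_inv[OF S] by (simp add: R_def)
    have lmi: "lmi Y L \<alpha> \<beta> \<longleftrightarrow> (\<forall>v w. \<beta> * (v \<bullet> v) + \<alpha> * (stack_vec v w \<bullet> (Q *v stack_vec v w)) \<le>
        v \<bullet> (Y *v v) - w \<bullet> (R Y L *v w))" for \<alpha> \<beta>
      unfolding lmi_def R_def S_def by (rule psd_block5_iff[OF symY symQ S[unfolded S_def]])
    have "robust Y L \<longleftrightarrow>
        (\<forall>Z v. 0 \<le> \<rho> + (\<Sum>r\<in>UNIV. (Z - Z0) $ r \<bullet> (H *v (Z - Z0) $ r)) \<longrightarrow> v \<noteq> 0 \<longrightarrow>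
            (transpose Z *v v) \<bullet> (R Y L *v (transpose Z *v v)) < v \<bullet> (Y *v v))"
      unfolding robust_def \<Sigma> all_hstack_iff by blast
    also have "\<dots> \<longleftrightarrow> (\<exists>\<alpha>\<ge>0. \<exists>\<beta>>0. lmi Y L \<alpha> \<beta>)"
      unfolding lmi by (rule ball_S_lemma[OF H psdR symY symQ Q \<open>\<rho> \<ge> 0\<close>])
    finally show ?thesis .
  qed
  have LMIs: "H2_LMIs u x \<Phi> \<phi> \<gamma> C D Y Z L \<alpha> \<beta> \<longleftrightarrow> lmi Y L \<alpha> \<beta> \<and> pd (S Y L) \<and>
      psd (block2 Z (mat 1) (mat 1) Y) \<and> trace Z < \<gamma>\<^sup>2" if "symmetric_mat Y" for Y Z L \<alpha> \<beta>
    unfolding H2_LMIs_def lmi_def S_def Q_def pd_block2_mat1_iff[OF that] ..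
  have informative: "informative (Theta_H2 \<gamma> C D) (M_H2 C D) u x (W_F \<Phi>) \<longleftrightarrow>
      (\<exists>Y L. symmetric_mat Y \<and> trace (matrix_inv Y) < \<gamma>\<^sup>2 \<and> pd (S Y L) \<and> robust Y L)"
  proof -
    define certified where "certified = (\<lambda>Y L. \<forall>(A, B)\<in>\<Sigma>.
      pd (transpose (vstack (mat 1) (vstack (transpose A) (transpose B))) **
        M_H2 C D (Y, L) ** vstack (mat 1) (vstack (transpose A) (transpose B))))"
    have "certified Y L \<longleftrightarrow> robust Y L" if "symmetric_mat Y" "pd (S Y L)" for Y L
      using pd_M_H2_iff[OF that[unfolded S_def]]
      unfolding certified_def robust_def R_def S_def by auto
    moreover have "informative (Theta_H2 \<gamma> C D) (M_H2 C D) u x (W_F \<Phi>) \<longleftrightarrow>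
        (\<exists>Y L. (symmetric_mat Y \<and> trace (matrix_inv Y) < \<gamma>\<^sup>2 \<and> pd (S Y L)) \<and> certified Y L)"
      unfolding informative_def Theta_H2_def Bex_def split_paired_Ex mem_Collect_eq prod.case
        certified_def S_def \<Sigma>_def ..
    ultimately show ?thesis by blast
  qed
  have pdY: "pd Y" if "symmetric_mat Y" "pd (S Y L)" for Y L
    using pd_add_gram that by (simp add: S_def)
  show ?thesis
  proof (intro conjI allI impI)
    show "informative (Theta_H2 \<gamma> C D) (M_H2 C D) u x (W_F \<Phi>) \<longleftrightarrow>
        (\<exists>Y Z L \<alpha> \<beta>. symmetric_mat Y \<and> symmetric_mat Z \<and> \<alpha> \<ge> 0 \<and> \<beta> > 0 \<and>
          H2_LMIs u x \<Phi> \<phi> \<gamma> C D Y Z L \<alpha> \<beta>)"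
    proof -
      have "symmetric_mat Y \<and> trace (matrix_inv Y) < \<gamma>\<^sup>2 \<and> pd (S Y L) \<and> robust Y L \<longleftrightarrow>
          (\<exists>Z \<alpha> \<beta>. symmetric_mat Y \<and> symmetric_mat Z \<and> \<alpha> \<ge> 0 \<and> \<beta> > 0 \<and>
            H2_LMIs u x \<Phi> \<phi> \<gamma> C D Y Z L \<alpha> \<beta>)" for Y L
      proof (cases "symmetric_mat Y \<and> pd (S Y L)")
        case True
        hence Y: "symmetric_mat Y" "pd (S Y L)" by auto
        show ?thesis
          unfolding robust_iff[OF Y] LMIs[OF Y(1)] trace_inverse_less_iff[OF pdY[OF Y], symmetric]
          using Y by blast
      next
        \<comment> \<open>Both sides fail, since the linear matrix inequalities force
          \<open>pd (S Y L)\<close>.\<close>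
        case False
        thus ?thesis using LMIs by blast
      qed
      note eq = this
      show ?thesis
        unfolding informative eq by (intro arg_cong[where f = Ex] ext) (rule ex_comm)
    qed
  next
    fix Y Z L \<alpha> \<beta>
    assume asm: "symmetric_mat Y \<and> symmetric_mat Z \<and> \<alpha> \<ge> 0 \<and> \<beta> > 0 \<and>
      H2_LMIs u x \<Phi> \<phi> \<gamma> C D Y Z L \<alpha> \<beta>"
    hence symY: "symmetric_mat Y" and S: "pd (S Y L)" by (auto simp: LMIs)
    have tr: "trace (matrix_inv Y) < \<gamma>\<^sup>2"
      using asm LMIs[OF symY] trace_inverse_less_iff[OF pdY[OF symY S]] by blast
    have robust: "robust Y L" using asm LMIs[OF symY] robust_iff[OF symY S] by blast
    define K where "K = L ** matrix_inv Y"
    have "schur_stable (A + B ** K) \<and> h2_norm (transfer_matrix (C + D ** K) (A + B ** K)) < \<gamma>"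
      if "(A, B) \<in> \<Sigma>" for A B
    proof -
      have lyap: "((A + B ** K) *v \<xi>) \<bullet> (matrix_inv Y *v ((A + B ** K) *v \<xi>)) +
          ((C + D ** K) *v \<xi>) \<bullet> ((C + D ** K) *v \<xi>) < \<xi> \<bullet> (matrix_inv Y *v \<xi>)" if "\<xi> \<noteq> 0" for \<xi>
        using closed_loop_lyapunov[OF symY S[unfolded S_def] that] robust \<open>(A, B) \<in> \<Sigma>\<close>
        unfolding robust_def R_def S_def K_def by blast
      note P = pd_matrix_inv(3)[OF pdY[OF symY S]]
      have "(h2_norm (transfer_matrix (C + D ** K) (A + B ** K)))\<^sup>2 < \<gamma>\<^sup>2"
        using h2_norm_power2_le_trace[OF P lyap] tr by (rule le_less_trans)
      hence "h2_norm (transfer_matrix (C + D ** K) (A + B ** K)) < \<gamma>"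
        using \<open>\<gamma> > 0\<close> by (simp add: power2_less_imp_less)
      thus ?thesis using lyapunov_imp_schur_stable[OF P lyap] by blast
    qed
    thus "let K = L ** matrix_inv Y in \<forall>(A, B) \<in> Sigma_D u x (W_F \<Phi>).
        schur_stable (A + B ** K) \<and> h2_norm (transfer_matrix (C + D ** K) (A + B ** K)) < \<gamma>"
      unfolding Let_def K_def[symmetric] \<Sigma>_def[symmetric] by blast
  qed
qed

end
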